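(* If $T$ is a tree with $\beta_s(T)=4$, then $\tau_s(T)=2$.
   Context: For vertices $u,v,w$ of a connected graph, $w$ strongly resolves $u,v$ if there is a shortest $u$-$w$ path containing $v$ or a shortest $v$-$w$ path containing $u$. A strong resolving set is a set $W$ such that every pair of vertices is strongly resolved by some vertex of $W$; the strong dimension $\beta_s(H)$ is the minimum size of a strong resolving set of $H$. The threshold strong dimension $\tau_s(G)$ is the minimum of $\beta_s(H)$ over all graphs $H$ having $G$ as a spanning subgraph. *)

theory Defs
  imports "Graph_Theory.Graph_Theory"
begin

text \<open>
  A finite simple graph is a \<open>pair_graph\<close>: a finite, loop-free, symmetric set of arcs, each
  arc being a pair of vertices. An undirected edge is thus a pair of opposite arcs.
\<close>

text \<open>
  The library predicates \<open>forest\<close> and \<open>tree\<close> count \<open>a, b, a\<close> as a cycle of a symmetric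
  digraph, so they do not describe undirected forests and trees; hence the definitions below,
  in which a cycle has at least three distinct vertices.
\<close>

definition undirected_cycle :: "'a pair_pre_digraph \<Rightarrow> 'a vwalk \<Rightarrow> bool" where
  "undirected_cycle G p \<longleftrightarrow> vpath p G \<and> 3 \<le> length p \<and> (last p, hd p) \<in> parcs G"

definition undirected_tree :: "'a pair_pre_digraph \<Rightarrow> bool" where
  "undirected_tree G \<longleftrightarrow> pair_graph G \<and> connected G \<and> (\<nexists>p. undirected_cycle G p)"

definition path_between :: "'a pair_pre_digraph \<Rightarrow> 'a \<Rightarrow> 'a vwalk \<Rightarrow> 'a \<Rightarrow> bool" where
  "path_between G u p v \<longleftrightarrow> vpath p G \<and> hd p = u \<and> last p = v"

definition shortest_path :: "'a pair_pre_digraph \<Rightarrow> 'a \<Rightarrow> 'a vwalk \<Rightarrow> 'a \<Rightarrow> bool" where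
  "shortest_path G u p v \<longleftrightarrow>
     path_between G u p v \<and> (\<forall>q. path_between G u q v \<longrightarrow> vwalk_length p \<le> vwalk_length q)"

definition strongly_resolves :: "'a pair_pre_digraph \<Rightarrow> 'a \<Rightarrow> 'a \<Rightarrow> 'a \<Rightarrow> bool" where
  "strongly_resolves G w u v \<longleftrightarrow>
     (\<exists>p. shortest_path G u p w \<and> v \<in> set p) \<or> (\<exists>p. shortest_path G v p w \<and> u \<in> set p)"

definition strong_resolving_set :: "'a pair_pre_digraph \<Rightarrow> 'a set \<Rightarrow> bool" where
  "strong_resolving_set G W \<longleftrightarrow> W \<subseteq> pverts G \<and>
     (\<forall>u \<in> pverts G. \<forall>v \<in> pverts G. u \<noteq> v \<longrightarrow> (\<exists>w \<in> W. strongly_resolves G w u v))"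

text \<open>For a connected \<open>pair_graph\<close> the whole vertex set is strong resolving, so the minimum exists.\<close>

definition strong_dimension :: "'a pair_pre_digraph \<Rightarrow> nat" where
  "strong_dimension G = (LEAST k. \<exists>W. strong_resolving_set G W \<and> card W = k)"

text \<open>
  The strong dimension is only meaningful for connected graphs, hence the restriction on \<open>H\<close>;
  it is automatic when \<open>G\<close> is connected. The vertex set of \<open>H\<close> is that of \<open>G\<close>, so letting
  \<open>H\<close> range over graphs on the same vertex type loses nothing.
\<close>

definition threshold_strong_dimension :: "'a pair_pre_digraph \<Rightarrow> nat" where
  "threshold_strong_dimension G =
     (LEAST k. \<exists>H :: 'a pair_pre_digraph.
        pair_graph H \<and> connected H \<and> spanning G H \<and> strong_dimension H = k)"

end

theory Submission
  imports Defs "HOL-Library.Multiset"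
begin

text \<open>
  A strong resolving set of a tree may miss at most one leaf, and the leaves without one of them
  form such a set, so a tree of strong dimension 4 has exactly five leaves. A supergraph with a
  strong resolving set of at most one vertex is a path, which excludes values below 2.

  For the upper bound the tree is laid out injectively on cells of \<open>\<int> \<times> \<int>\<close> so that adjacent
  vertices are a king's move apart. The cells are initial segments of the rows \<open>(i, i + 1)\<close> and
  \<open>(i + 1, i)\<close> and an interval of the diagonal between them. The king's graph on such a set is
  isometric for the maximum metric, and the coordinates of a cell are its distances from the cells
  \<open>(0, 1)\<close> and \<open>(1, 0)\<close>; hence these two vertices strongly resolve every pair.

  A tree with five leaves consists of a (possibly trivial) spine with two legs at either end and one
  leg in between. The first two legs bend around the bottom of the strip and meet at their common
  vertex, the spine then snakes upwards through all three rows up to the middle leg, which occupies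
  one side row, while the rest of the spine zigzags through the other two rows until it splits into
  the last two legs. The upper ends of the rows may be ragged, so only a parity problem at
  the bottom remains.
\<close>

section \<open>Walks, distances and strong resolving sets\<close>

lemma vwalk_with_proj:
  "vwalk p (with_proj G) \<longleftrightarrow> p \<noteq> [] \<and> set p \<subseteq> pverts G \<and> set (vwalk_arcs p) \<subseteq> parcs G"
  by (auto simp: vwalk_def)

lemma vpath_with_proj:
  "vpath p (with_proj G) \<longleftrightarrow>
    p \<noteq> [] \<and> distinct p \<and> set p \<subseteq> pverts G \<and> set (vwalk_arcs p) \<subseteq> parcs G"
  by (auto simp: vpath_def vwalk_with_proj)

lemma pair_graph_sym:
  assumes "pair_graph G" "(u, v) \<in> parcs G"
  shows "(v, u) \<in> parcs G"
proof -
  interpret pair_graph G by fact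
  from assms(2) sym_arcs show ?thesis by (auto simp: symmetric_def dest: symD)
qed

lemma pair_graph_wf:
  assumes "pair_graph G" "(u, v) \<in> parcs G"
  shows "u \<in> pverts G" "v \<in> pverts G" "u \<noteq> v"
proof -
  interpret pair_graph G by fact
  show "u \<in> pverts G" "v \<in> pverts G" using assms(2) by (auto dest: wellformed')
  show "u \<noteq> v" using pair_no_loops[OF assms(2)] by simp
qed

lemma pair_graph_finite: "pair_graph G \<Longrightarrow> finite (pverts G)"
  by (simp add: pair_fin_digraph.pair_finite_verts pair_graph.axioms(1) pair_digraph.axioms(1))

lemma pair_graphI:
  assumes "finite (pverts G)" "parcs G \<subseteq> pverts G \<times> pverts G" "sym (parcs G)" "irrefl (parcs G)"
  shows "pair_graph G"
proof
  show "finite (parcs G)" using assms(1,2) by (meson finite_SigmaI finite_subset)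
qed (use assms in \<open>auto simp: symmetric_def irrefl_def\<close>)

text \<open>Connectedness is defined through the symmetric closure, which changes nothing for a
  \<open>pair_graph\<close>.\<close>

lemma connected_iff_rtrancl:
  assumes "pair_graph G"
  shows "connected G \<longleftrightarrow> pverts G \<noteq> {} \<and> pverts G \<times> pverts G \<subseteq> (parcs G)\<^sup>*"
proof -
  interpret pair_graph G by fact
  have "parcs (mk_symmetric G) = parcs G"
    using pair_graph_sym[OF assms] by (fastforce simp: mk_symmetric_def)
  moreover have "pverts (mk_symmetric G) = pverts G"
    by (simp add: mk_symmetric_def)
  ultimately have "reachable (with_proj (mk_symmetric G)) u v \<longleftrightarrow> reachable (with_proj G) u v"
    and "verts (with_proj (mk_symmetric G)) = pverts G" for u v
    by (simp_all add: reachable_def)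
  then have "connected G \<longleftrightarrow>
      pverts G \<noteq> {} \<and> (\<forall>u \<in> pverts G. \<forall>v \<in> pverts G. reachable (with_proj G) u v)"
    by (simp only: connected_def strongly_connected_def)
  also have "\<dots> \<longleftrightarrow> pverts G \<noteq> {} \<and> (\<forall>u \<in> pverts G. \<forall>v \<in> pverts G. (u, v) \<in> (parcs G)\<^sup>*)"
    by (intro conj_cong refl ball_cong reachable_conv')
  finally show ?thesis by (simp only: subset_iff split_paired_All mem_Times_iff fst_conv snd_conv) blast
qed

lemma vwalk_imp_path_between:
  assumes "vwalk p (with_proj G)" "hd p = u" "last p = v"
  shows "\<exists>q. path_between G u q v \<and> set q \<subseteq> set p"
  using assms vwalk_to_vpath_hd[of p] vwalk_to_vpath_last[of p] vwalk_to_vpath_vpath[of p]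
    vwalk_to_vpath_subset[of _ p]
  unfolding path_between_def by (intro exI[of _ "vwalk_to_vpath p"]) auto

lemma rtrancl_imp_path_between:
  assumes "pair_graph G" "(u, v) \<in> (parcs G)\<^sup>*" "u \<in> pverts G"
  shows "\<exists>p. path_between G u p v"
proof -
  have "\<exists>p. vwalk p (with_proj G) \<and> hd p = u \<and> last p = v"
    using assms(2,3)
  proof (induction rule: converse_rtrancl_induct)
    case base
    then show ?case by (intro exI[of _ "[v]"]) (simp add: vwalk_with_proj)
  next
    case (step y z)
    then obtain p where "vwalk p (with_proj G)" "hd p = z" "last p = v"
      using pair_graph_wf(2)[OF assms(1) step(1)] by auto
    with step(1,4) show ?case
      by (intro exI[of _ "y # p"]) (auto simp: vwalk_with_proj)
  qed
  then obtain p where "vwalk p (with_proj G)" "hd p = u" "last p = v" by auto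
  from vwalk_imp_path_between[OF this] show ?thesis by auto
qed

lemma connected_imp_path_between:
  assumes "pair_graph G" "connected G" "u \<in> pverts G" "v \<in> pverts G"
  shows "\<exists>p. path_between G u p v"
proof -
  have "(u, v) \<in> (parcs G)\<^sup>*"
    using assms(2-4) unfolding connected_iff_rtrancl[OF assms(1)] by (metis SigmaI subsetD)
  then show ?thesis using rtrancl_imp_path_between assms(1,3) by metis
qed

lemma connected_imp_shortest_path:
  assumes "pair_graph G" "connected G" "u \<in> pverts G" "v \<in> pverts G"
  shows "\<exists>p. shortest_path G u p v"
proof -
  obtain q where "path_between G u q v"
    using connected_imp_path_between[OF assms] by (elim exE)
  then have "\<exists>p. path_between G u p v \<and>
      (\<forall>q. path_between G u q v \<longrightarrow> vwalk_length p \<le> vwalk_length q)"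
    by (rule ex_has_least_nat)
  then show ?thesis by (simp only: shortest_path_def)
qed

text \<open>A potential that drops by at most one along every arc needs at least
  \<open>D (hd p)\<close> arcs to reach zero, and a walk has one vertex more than arcs. With
  \<open>D\<close> the distance to a target, this is the lower bound that makes a path
  shortest.\<close>

lemma vwalk_length_ge:
  assumes "\<And>x y. (x, y) \<in> parcs G \<Longrightarrow> D x \<le> Suc (D y)"
    and "vwalk p (with_proj G)" "D (last p) = 0"
  shows "D (hd p) < length p"
  using assms(2,3)
proof (induction p rule: list.induct)
  case (Cons u p)
  then show ?case
    using assms(1)[of u "hd p"] by (cases "p = []") (auto simp: vwalk_with_proj)
qed (simp add: vwalk_with_proj)

lemma vwalk_glue:
  assumes "vwalk p (with_proj G)" "vwalk q (with_proj G)" "last p = hd q"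
  shows "vwalk (p @ tl q) (with_proj G)" "hd (p @ tl q) = hd p" "last (p @ tl q) = last q"
proof -
  have ne: "p \<noteq> []" "q \<noteq> []" using assms by (simp_all add: vwalk_with_proj)
  then obtain x q' where q: "q = x # q'" by (cases q) auto
  show "vwalk (p @ tl q) (with_proj G)"
    using assms q by (cases "q' = []") (auto simp: vwalk_with_proj vwalk_arcs_append)
  show "hd (p @ tl q) = hd p" using ne by simp
  show "last (p @ tl q) = last q" using ne assms(3) q by (cases "q' = []") auto
qed

text \<open>A walk that meets the bound of \<open>vwalk_length_ge\<close> has to lower
  \<open>D\<close> by exactly one in each step, so its vertices lie on different levels and none
  repeats.\<close>

lemma tight_vwalk_distinct:
  assumes lip: "\<And>x y. (x, y) \<in> parcs G \<Longrightarrow> D x \<le> Suc (D y)"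
    and "vwalk p (with_proj G)" "D (last p) = 0" "length p = Suc (D (hd p))"
  shows "distinct p \<and> (\<forall>x \<in> set p. D x \<le> D (hd p))"
  using assms(2-)
proof (induction p rule: list.induct)
  case (Cons u p)
  show ?case
  proof (cases "p = []")
    case False
    then have walk: "vwalk p (with_proj G)" "D (last p) = 0" and arc: "(u, hd p) \<in> parcs G"
      using Cons.prems by (auto simp: vwalk_with_proj)
    have "D (hd p) < length p"
      using vwalk_length_ge[of G D p] lip walk by blast
    with lip[OF arc] Cons.prems(3) have "length p = Suc (D (hd p))" "D u = Suc (D (hd p))"
      by auto
    with Cons.IH walk show ?thesis by force
  qed simp
qed simp

text \<open>The first three hypotheses certify \<open>D\<close> as the graph distance:
  \<open>lip\<close> and \<open>zero\<close> make it a lower bound for the length of walks, and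
  \<open>descent\<close> supplies walks of that length. Equality in the triangle inequality then
  puts \<open>v\<close> on a shortest path from \<open>u\<close> to \<open>w\<close>.\<close>

lemma strongly_resolvesI:
  assumes lip: "\<And>x y z. (x, y) \<in> parcs G \<Longrightarrow> z \<in> pverts G \<Longrightarrow> D x z \<le> Suc (D y z)"
    and zero: "\<And>x. x \<in> pverts G \<Longrightarrow> D x x = 0"
    and descent: "\<And>x z. x \<in> pverts G \<Longrightarrow> z \<in> pverts G \<Longrightarrow> x \<noteq> z
      \<Longrightarrow> \<exists>y. y \<in> pverts G \<and> (x, y) \<in> parcs G \<and> D x z = Suc (D y z)"
    and V: "u \<in> pverts G" "v \<in> pverts G" "w \<in> pverts G"
    and sum: "D u w = D u v + D v w"
  shows "strongly_resolves G w u v"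
proof -
  \<comment> \<open>Repeated descent reaches \<open>z\<close> after exactly \<open>D x z\<close>
    steps.\<close>
  have walk: "\<exists>p. vwalk p (with_proj G) \<and> hd p = x \<and> last p = z \<and> length p = Suc (D x z)"
    if "x \<in> pverts G" "z \<in> pverts G" for x z
    using that
  proof (induction "D x z" arbitrary: x)
    case 0
    then have "x = z" using descent by fastforce
    with 0 show ?case by (intro exI[of _ "[x]"]) (simp add: vwalk_with_proj)
  next
    case (Suc n)
    then have "x \<noteq> z" using zero by force
    then obtain y where y: "y \<in> pverts G" "(x, y) \<in> parcs G" "D x z = Suc (D y z)"
      using descent Suc.prems by blast
    with Suc obtain p where "vwalk p (with_proj G)" "hd p = y" "last p = z" "length p = Suc (D y z)"
      by (metis nat.inject)
    with y Suc.prems show ?case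
      by (intro exI[of _ "x # p"]) (auto simp: vwalk_with_proj)
  qed
  obtain p where p: "vwalk p (with_proj G)" "hd p = u" "last p = v" "length p = Suc (D u v)"
    using walk V by blast
  obtain q where q: "vwalk q (with_proj G)" "hd q = v" "last q = w" "length q = Suc (D v w)"
    using walk V by blast
  define r where "r = p @ tl q"
  have "vwalk r (with_proj G)" "hd r = u" "last r = w"
    using vwalk_glue[OF p(1) q(1)] p q by (simp_all add: r_def)
  moreover have "length r = Suc (D u w)" using p q sum by (simp add: r_def)
  moreover have "v \<in> set r" using p last_in_set[of p] by (auto simp: r_def vwalk_with_proj)
  ultimately have r: "vwalk r (with_proj G)" "hd r = u" "last r = w" "length r = Suc (D u w)" "v \<in> set r" .
  have "distinct r"
    using tight_vwalk_distinct[of G "\<lambda>x. D x w" r] lip zero r V by auto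
  then have "path_between G u r w"
    using r by (simp add: path_between_def vpath_def)
  moreover have "vwalk_length r \<le> vwalk_length s" if "path_between G u s w" for s
    using vwalk_length_ge[of G "\<lambda>x. D x w" s] that lip zero r V
    by (auto simp: path_between_def vpath_def)
  ultimately have "shortest_path G u r w"
    unfolding shortest_path_def by simp
  with r(5) show ?thesis unfolding strongly_resolves_def by (intro disjI1 exI conjI)
qed

lemma strongly_resolves_commute: "strongly_resolves G w u v \<longleftrightarrow> strongly_resolves G w v u"
  unfolding strongly_resolves_def by (rule disj_commute)

text \<open>Each vertex resolves the pairs that contain it, being the end of every shortest path
  towards it. Hence the \<open>LEAST\<close> in \<open>strong_dimension\<close> is attained.\<close>

lemma strong_resolving_set_pverts:
  assumes "pair_graph G" "connected G"
  shows "strong_resolving_set G (pverts G)"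
proof -
  have "strongly_resolves G u u v" if uv: "u \<in> pverts G" "v \<in> pverts G" for u v
  proof -
    obtain p where p: "shortest_path G v p u"
      using connected_imp_shortest_path[OF assms uv(2,1)] by blast
    then have "u \<in> set p"
      by (auto simp: shortest_path_def path_between_def vpath_def vwalk_def)
    with p show ?thesis unfolding strongly_resolves_def by (intro disjI2 exI conjI)
  qed
  then show ?thesis unfolding strong_resolving_set_def by (intro conjI ballI impI bexI) simp_all
qed

lemma strong_dimension_le: "strong_resolving_set G W \<Longrightarrow> strong_dimension G \<le> card W"
  unfolding strong_dimension_def by (intro Least_le exI[of _ W] conjI) simp_all

lemma strong_dimension_attained:
  assumes "pair_graph G" "connected G"
  shows "\<exists>W. strong_resolving_set G W \<and> card W = strong_dimension G"
proof -
  have "\<exists>W. strong_resolving_set G W \<and> card W = card (pverts G)"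
    using strong_resolving_set_pverts[OF assms] by (intro exI[of _ "pverts G"] conjI) simp_all
  then show ?thesis
    unfolding strong_dimension_def by (rule LeastI)
qed

section \<open>Strong resolving sets with one vertex\<close>

lemma spanning_pair_iff:
  assumes "pair_graph T" "pair_graph H"
  shows "spanning (with_proj T) (with_proj H) \<longleftrightarrow> pverts T = pverts H \<and> parcs T \<subseteq> parcs H"
proof -
  interpret T: pair_graph T by fact
  interpret H: pair_graph H by fact
  have "wf_digraph (with_proj T)" "wf_digraph (with_proj H)"
    by unfold_locales
  then show ?thesis
    by (auto simp: spanning_def subgraph_def compatible_def)
qed

text \<open>A discrete intermediate value property: levels drop by at most one per step, so a walk
  that starts at or above \<open>k\<close> and ends at or below \<open>k\<close> cannot skip
  it.\<close>

lemma vwalk_attains_level: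
  fixes L :: "'a \<Rightarrow> nat"
  assumes lip: "\<And>x y. (x, y) \<in> parcs G \<Longrightarrow> L x \<le> Suc (L y)"
    and "vwalk p (with_proj G)" "L (last p) \<le> k" "k \<le> L (hd p)"
  shows "\<exists>x \<in> set p. L x = k"
  using assms(2-)
proof (induction p rule: list.induct)
  case (Cons u p)
  show ?case
  proof (cases "L u = k \<or> p = []")
    case False
    then have "(u, hd p) \<in> parcs G" "vwalk p (with_proj G)"
      using Cons.prems by (auto simp: vwalk_with_proj)
    moreover have "k \<le> L (hd p)"
      using lip[OF calculation(1)] False Cons.prems by simp
    ultimately show ?thesis using Cons.IH Cons.prems False by auto
  qed (use Cons.prems in auto)
qed (simp add: vwalk_with_proj)

lemma path_between_suffix:
  assumes "path_between G u (p @ v # q) w"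
  shows "path_between G v (v # q) w"
  using assms vwalkI_append_r[of "v # q" p "with_proj G"]
  by (auto simp: path_between_def vpath_def)

text \<open>If \<open>{w}\<close> strongly resolves \<open>H\<close>, no two vertices have the same distance from \<open>w\<close> in \<open>H\<close>.
  A path of \<open>T\<close> towards \<open>w\<close> changes that distance by at most one in each step, so it runs through
  every vertex that is closer to \<open>w\<close> than its start.\<close>

lemma singleton_resolving_spanning_subgraph:
  assumes T: "pair_graph T" "connected T" and H: "pair_graph H" "connected H"
    and span: "pverts T = pverts H" "parcs T \<subseteq> parcs H"
    and res: "strong_resolving_set H {w}"
  shows "strong_resolving_set T {w}"
proof -
  \<comment> \<open>\<open>L x\<close> counts the vertices of a shortest path from \<open>x\<close>
    to \<open>w\<close> in \<open>H\<close>, so it is the distance plus one.\<close>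
  define L where "L x = (LEAST n. \<exists>p. path_between H x p w \<and> length p = n)" for x
  have w: "w \<in> pverts H" using res by (simp add: strong_resolving_set_def)
  have le: "L x \<le> length p" if "path_between H x p w" for x p
    unfolding L_def by (rule Least_le) (use that in auto)
  have attained: "\<exists>p. path_between H x p w \<and> length p = L x" if x: "x \<in> pverts H" for x
  proof -
    obtain p where "path_between H x p w" using connected_imp_path_between[OF H x w] ..
    then have "\<exists>q. path_between H x q w \<and> length q = length p" by auto
    then show ?thesis unfolding L_def by (rule LeastI)
  qed
  have lip: "L x \<le> Suc (L y)" if xy: "(x, y) \<in> parcs H" for x y
  proof -
    have x: "x \<in> pverts H" and y: "y \<in> pverts H" using pair_graph_wf[OF H(1) xy] by auto
    obtain p where p: "path_between H y p w" "length p = L y" using attained[OF y] by auto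
    have "vwalk (x # p) (with_proj H)" "last (x # p) = w"
      using p xy x by (auto simp: path_between_def vpath_with_proj vwalk_with_proj)
    then obtain q where q: "path_between H x q w" "set q \<subseteq> set (x # p)"
      using vwalk_imp_path_between[of "x # p" H x w] by auto
    have "L x \<le> length q" using le q by simp
    also have "length q = card (set q)"
      using q(1) by (simp add: path_between_def vpath_def distinct_card)
    also have "\<dots> \<le> card (set (x # p))" using q(2) by (intro card_mono) auto
    also have "\<dots> \<le> Suc (L y)" using card_length[of "x # p"] p by simp
    finally show ?thesis .
  qed
  \<comment> \<open>The part of a shortest path from \<open>v\<close> onwards is a path to
    \<open>w\<close> with fewer vertices.\<close>
  have closer: "L v < L u" if p: "shortest_path H u p w" "v \<in> set p" "u \<noteq> v" for u v p
  proof -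
    obtain q r where p_eq: "p = q @ v # r" using p(2) by (auto simp: in_set_conv_decomp)
    with p have "q \<noteq> []" by (auto simp: shortest_path_def path_between_def)
    have path: "path_between H u p w" using p by (simp add: shortest_path_def)
    then have "u \<in> pverts H"
      by (auto simp: path_between_def vpath_with_proj)
    then obtain s where s: "path_between H u s w" "length s = L u" using attained by auto
    then have "length p - 1 \<le> length s - 1" "s \<noteq> []"
      using p by (auto simp: shortest_path_def path_between_def vpath_with_proj)
    then have "length p \<le> L u" using s by (cases s) auto
    moreover have "L v \<le> length (v # r)"
      using le path_between_suffix path p_eq by fastforce
    ultimately show ?thesis using \<open>q \<noteq> []\<close> p_eq by (cases q) auto
  qed
  \<comment> \<open>If one of two vertices lies on a shortest path from the other to
    \<open>w\<close>, it is strictly closer to \<open>w\<close>; so \<open>w\<close> can only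
    resolve vertices of different levels.\<close>
  have level: "L u \<noteq> L v" if "u \<in> pverts H" "v \<in> pverts H" "u \<noteq> v" for u v
  proof -
    have "strongly_resolves H w u v"
      using res that by (simp add: strong_resolving_set_def)
    then show ?thesis
      unfolding strongly_resolves_def using closer that by (metis less_irrefl)
  qed
  have "L w \<le> L v" if "v \<in> pverts H" for v
  proof -
    have "path_between H w [w] w" using w by (simp add: path_between_def vpath_with_proj)
    then have "L w \<le> 1" using le by fastforce
    moreover obtain p where p: "path_between H v p w" "length p = L v"
      using attained \<open>v \<in> pverts H\<close> by auto
    then have "p \<noteq> []" by (simp add: path_between_def vpath_with_proj)
    then have "L v \<noteq> 0" using p(2) by (metis length_0_conv)
    ultimately show ?thesis by simp
  qed
  then have on_path: "\<exists>p. shortest_path T u p w \<and> v \<in> set p"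
    if uv: "u \<in> pverts T" "v \<in> pverts T" "L v \<le> L u" for u v
  proof -
    obtain p where p: "shortest_path T u p w"
      using connected_imp_shortest_path[OF T uv(1), of w] w span by auto
    then have walk: "vwalk p (with_proj T)" "hd p = u" "last p = w"
      by (auto simp: shortest_path_def path_between_def vpath_def)
    \<comment> \<open>The arcs of \<open>p\<close> are also arcs of \<open>H\<close>, so
      \<open>p\<close> meets the level of \<open>v\<close>, and \<open>v\<close> is the only vertex
      on that level.\<close>
    then obtain x where x: "x \<in> set p" "L x = L v"
      using vwalk_attains_level[of T L p "L v"] lip span uv \<open>\<And>v. v \<in> pverts H \<Longrightarrow> L w \<le> L v\<close> by blast
    then have "x = v" using level[of x v] walk uv span by (auto simp: vwalk_with_proj)
    then show ?thesis using p x by blast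
  qed
  show ?thesis
    unfolding strong_resolving_set_def
  proof (intro conjI ballI impI)
    fix u v assume uv: "u \<in> pverts T" "v \<in> pverts T"
    have "strongly_resolves T w u v"
    proof (cases "L v \<le> L u")
      case True
      then show ?thesis unfolding strongly_resolves_def using on_path[OF uv] by simp
    next
      case False
      then show ?thesis unfolding strongly_resolves_def using on_path[OF uv(2,1)] by simp
    qed
    then show "\<exists>x \<in> {w}. strongly_resolves T x u v" by simp
  qed (use w span in simp)
qed

text \<open>A strong resolving set of \<open>H\<close> with fewer than two vertices would also
  resolve \<open>T\<close>: a singleton by the previous lemma, the empty set because it only works
  when there are no two distinct vertices.\<close>

lemma strong_dimension_spanning_supergraph_ge_2:
  assumes T: "pair_graph T" "connected T" and H: "pair_graph H" "connected H"
    and span: "pverts T = pverts H" "parcs T \<subseteq> parcs H"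
    and dim: "1 < strong_dimension T"
  shows "2 \<le> strong_dimension H"
proof (rule ccontr)
  assume "\<not> 2 \<le> strong_dimension H"
  then obtain W where W: "strong_resolving_set H W" "card W < 2"
    using strong_dimension_attained[OF H] by auto
  have "finite W"
    using W(1) pair_graph_finite[OF H(1)] by (auto simp: strong_resolving_set_def finite_subset)
  then consider "W = {}" | w where "W = {w}"
    using W(2) by (metis One_nat_def card_1_singletonE card_eq_0_iff less_2_cases)
  then have "strong_resolving_set T W"
  proof cases
    case 1
    then show ?thesis using W(1) span by (simp add: strong_resolving_set_def)
  next
    case 2
    then show ?thesis using singleton_resolving_spanning_subgraph[OF T H span] W(1) by simp
  qed
  then show False using strong_dimension_le[of T W] W(2) dim by simp
qed

section \<open>Isometric strips of the king's graph\<close>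

definition king_dist :: "int \<times> int \<Rightarrow> int \<times> int \<Rightarrow> nat" where
  "king_dist p q = nat (max \<bar>fst p - fst q\<bar> \<bar>snd p - snd q\<bar>)"

text \<open>The index in a list determines the cell, so appending to a list fills the next free cell
  of a row. A relation instead of a function allows layouts to be extended before the lists are
  known to be disjoint.\<close>

inductive cell :: "nat \<Rightarrow> 'a list \<Rightarrow> 'a list \<Rightarrow> 'a list \<Rightarrow> 'a \<Rightarrow> int \<times> int \<Rightarrow> bool"
  for lo A B C where
  cellA: "i < length A \<Longrightarrow> cell lo A B C (A ! i) (int i, int i + 1)"
| cellB: "i < length B \<Longrightarrow> cell lo A B C (B ! i) (int i + 1, int i)"
| cellC: "i < length C \<Longrightarrow> cell lo A B C (C ! i) (int (lo + i), int (lo + i))"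

definition strip_edges :: "nat \<Rightarrow> 'a list \<Rightarrow> 'a list \<Rightarrow> 'a list \<Rightarrow> 'a rel" where
  "strip_edges lo A B C =
    {(u, v). \<exists>p q. cell lo A B C u p \<and> cell lo A B C v q \<and> king_dist p q = 1}"

text \<open>The occupied cells as a condition on integers alone, which leaves the proof of isometry
  to linear arithmetic. The side rows have lengths \<open>a\<close> and \<open>b\<close>, and
  \<open>(hi, hi)\<close> is the first free cell above the diagonal interval.\<close>

definition in_strip :: "int \<Rightarrow> int \<Rightarrow> int \<Rightarrow> int \<Rightarrow> int \<Rightarrow> int \<Rightarrow> bool" where
  "in_strip a b lo hi x y \<longleftrightarrow> y = x + 1 \<and> 0 \<le> x \<and> x < a \<or> x = y + 1 \<and> 0 \<le> y \<and> y < b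
    \<or> x = y \<and> lo \<le> x \<and> x < hi"

lemma in_strip_swap: "in_strip a b lo hi x y \<longleftrightarrow> in_strip b a lo hi y x"
  by (auto simp: in_strip_def)

text \<open>For isometry, each cell needs an occupied neighbour one step nearer to any other given
  cell. From a side row this neighbour lies along the row or in the row of the target.\<close>

lemma strip_descent_side:
  assumes lo: "1 \<le> lo" "lo \<le> a" "lo \<le> b"
    and p: "0 \<le> x" "x < a"
    and q: "in_strip a b lo hi z w" "(x, x + 1) \<noteq> (z, w)"
  shows "\<exists>r s. in_strip a b lo hi r s \<and> max \<bar>x - r\<bar> \<bar>x + 1 - s\<bar> = 1
    \<and> max \<bar>x - z\<bar> \<bar>x + 1 - w\<bar> = 1 + max \<bar>r - z\<bar> \<bar>s - w\<bar>"
proof -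
  consider (A) "w = z + 1" "0 \<le> z" "z < a" | (B) "z = w + 1" "0 \<le> w" "w < b"
    | (C) "z = w" "lo \<le> z" "z < hi"
    using q(1) unfolding in_strip_def by blast
  then show ?thesis
  proof cases
    case A
    then consider "x < z" | "z < x"
      using q(2) by fastforce
    then show ?thesis
    proof cases
      case 1
      then show ?thesis using A p lo
        by (intro exI[of _ "x + 1"] exI[of _ "x + 2"] conjI) (simp add: in_strip_def, linarith+)
    next
      case 2
      then show ?thesis using A p lo
        by (intro exI[of _ "x - 1"] exI[of _ "x"] conjI) (simp add: in_strip_def, linarith+)
    qed
  next
    case B
    then consider "x \<le> w" | "w < x"
      using q(2) by fastforce
    then show ?thesis
    proof cases
      case 1
      then show ?thesis using B p lo
        by (intro exI[of _ "x + 1"] exI[of _ "x"] conjI) (simp add: in_strip_def, linarith+)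
    next
      case 2
      then show ?thesis using B p lo
        by (intro exI[of _ "x - 1"] exI[of _ "x"] conjI) (simp add: in_strip_def, linarith+)
    qed
  next
    case C
    then consider "z < x" | "z = x \<or> z = x + 1" | "x + 1 < z" "x + 1 < a" | "x + 1 < z" "x + 1 = a"
      using p by linarith
    then show ?thesis
    proof cases
      case 1
      then show ?thesis using C p lo
        by (intro exI[of _ "x - 1"] exI[of _ "x"] conjI) (simp add: in_strip_def, linarith+)
    next
      case 2
      then show ?thesis using C p lo
        by (intro exI[of _ "z"] exI[of _ "z"] conjI) (simp add: in_strip_def, linarith+)
    next
      case 3
      then show ?thesis using C p lo
        by (intro exI[of _ "x + 1"] exI[of _ "x + 2"] conjI) (simp add: in_strip_def, linarith+)
    next
      \<comment> \<open>The row ends below the target; the cell \<open>(a, a)\<close> is occupied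
        because \<open>lo \<le> a\<close> and \<open>a < z\<close>.\<close>
      case 4
      then show ?thesis using C p lo
        by (intro exI[of _ "x + 1"] exI[of _ "x + 1"] conjI) (simp add: in_strip_def, linarith+)
    qed
  qed
qed

text \<open>Targets in row \<open>B\<close> will follow by reflection, whence
  \<open>z \<le> w\<close>. A target in row \<open>A\<close> is approached by changing into that
  row, except when \<open>a < x\<close>; then the step goes down the diagonal, and
  \<open>lo \<le> a\<close> keeps it inside.\<close>

lemma strip_descent_middle:
  assumes lo: "1 \<le> lo" "lo \<le> a" "lo \<le> b"
    and p: "lo \<le> x" "x < hi"
    and q: "in_strip a b lo hi z w" "(x, x) \<noteq> (z, w)" "z \<le> w"
  shows "\<exists>r s. in_strip a b lo hi r s \<and> max \<bar>x - r\<bar> \<bar>x - s\<bar> = 1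
    \<and> max \<bar>x - z\<bar> \<bar>x - w\<bar> = 1 + max \<bar>r - z\<bar> \<bar>s - w\<bar>"
proof -
  consider
      "z = w" "x < z" "z < hi" 
    | "z = w" "lo \<le> z" "z < x" | "w = z + 1" "z < a" "a < x"
    | "w = z + 1" "x \<le> z" "z < a"
    | "w = z + 1" "0 \<le> z" "z < x" "x \<le> a"
    using p q unfolding in_strip_def by (smt (verit))
  then show ?thesis
  proof cases
    case 1
    then show ?thesis using p
      by (intro exI[of _ "x + 1"] exI[of _ "x + 1"] conjI) (simp add: in_strip_def, linarith+)
  next
    case 2
    then show ?thesis using p
      by (intro exI[of _ "x - 1"] exI[of _ "x - 1"] conjI) (simp add: in_strip_def, linarith+)
  next
    case 3
    then show ?thesis using p lo
      by (intro exI[of _ "x - 1"] exI[of _ "x - 1"] conjI) (simp add: in_strip_def, linarith+)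
  next
    case 4
    then show ?thesis using p lo
      by (intro exI[of _ x] exI[of _ "x + 1"] conjI) (simp add: in_strip_def, linarith+)
  next
    case 5
    then show ?thesis using p lo
      by (intro exI[of _ "x - 1"] exI[of _ x] conjI) (simp add: in_strip_def, linarith+)
  qed
qed

lemma strip_descent:
  assumes lo: "1 \<le> lo" "lo \<le> a" "lo \<le> b"
    and p: "in_strip a b lo hi x y" and q: "in_strip a b lo hi z w" and ne: "(x, y) \<noteq> (z, w)"
  shows "\<exists>r s. in_strip a b lo hi r s \<and> max \<bar>x - r\<bar> \<bar>y - s\<bar> = 1
    \<and> max \<bar>x - z\<bar> \<bar>y - w\<bar> = 1 + max \<bar>r - z\<bar> \<bar>s - w\<bar>"
proof -
  consider (A) "y = x + 1" "0 \<le> x" "x < a" | (B) "x = y + 1" "0 \<le> y" "y < b"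
    | (C) "x = y" "lo \<le> x" "x < hi" "z \<le> w" | (C') "x = y" "lo \<le> y" "y < hi" "w \<le> z"
    using p unfolding in_strip_def by (smt (verit))
  then show ?thesis
  proof cases
    case A
    then show ?thesis using strip_descent_side[OF lo A(2,3) q] ne by simp
  next
    case B
    obtain s r where "in_strip b a lo hi s r \<and> max \<bar>y - s\<bar> \<bar>y + 1 - r\<bar> = 1
      \<and> max \<bar>y - w\<bar> \<bar>y + 1 - z\<bar> = 1 + max \<bar>s - w\<bar> \<bar>r - z\<bar>"
      using strip_descent_side[OF lo(1,3,2) B(2,3), of hi w z] B ne q by (auto simp: in_strip_swap[of b a])
    then show ?thesis
      using B by (intro exI[of _ r] exI[of _ s]) (simp add: in_strip_swap[of b a] max.commute)
  next
    case C
    then show ?thesis using strip_descent_middle[OF lo C(2,3) q _ C(4)] ne by simp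
  next
    case C'
    obtain s r where "in_strip b a lo hi s r \<and> max \<bar>y - s\<bar> \<bar>y - r\<bar> = 1
      \<and> max \<bar>y - w\<bar> \<bar>y - z\<bar> = 1 + max \<bar>s - w\<bar> \<bar>r - z\<bar>"
      using strip_descent_middle[OF lo(1,3,2) C'(2,3), of w z] C' ne q by (auto simp: in_strip_swap[of b a])
    then show ?thesis
      using C' by (intro exI[of _ r] exI[of _ s]) (simp add: in_strip_swap[of b a] max.commute)
  qed
qed

section \<open>From cells to a supergraph of strong dimension at most two\<close>

lemma king_dist_commute: "king_dist p q = king_dist q p"
  by (simp add: king_dist_def abs_minus_commute)

lemma king_dist_le_iff:
  "king_dist p q \<le> n \<longleftrightarrow> \<bar>fst p - fst q\<bar> \<le> int n \<and> \<bar>snd p - snd q\<bar> \<le> int n"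
  by (simp add: king_dist_def nat_le_iff)

lemma king_dist_triangle: "king_dist p r \<le> king_dist p q + king_dist q r"
proof -
  note king_dist_le_iff[of p q "king_dist p q"] king_dist_le_iff[of q r "king_dist q r"]
  then show ?thesis unfolding king_dist_le_iff[of p r] by (auto simp: abs_le_iff)
qed

lemma king_dist_attained:
  "int (king_dist p q) \<in> {fst p - fst q, fst q - fst p, snd p - snd q, snd q - snd p}"
  by (simp add: king_dist_def max_def abs_if)

lemma cell_in_strip:
  "cell lo A B C u (x, y) \<Longrightarrow> in_strip (int (length A)) (int (length B)) (int lo) (int (lo + length C)) x y"
  by (auto elim!: cell.cases simp: in_strip_def)

lemma in_strip_cell:
  assumes "in_strip (int (length A)) (int (length B)) (int lo) (int (lo + length C)) x y"
  shows "\<exists>u. cell lo A B C u (x, y)"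
  using assms unfolding in_strip_def
proof (elim disjE conjE)
  assume "y = x + 1" "0 \<le> x" "x < int (length A)"
  then show ?thesis using cellA[of "nat x" A lo B C] by (auto simp: nat_less_iff)
next
  assume "x = y + 1" "0 \<le> y" "y < int (length B)"
  then show ?thesis using cellB[of "nat y" B lo A C] by (auto simp: nat_less_iff)
next
  assume "x = y" "int lo \<le> x" "x < int (lo + length C)"
  then show ?thesis using cellC[of "nat x - lo" C lo A B] 
    by (intro exI[of _ "C ! (nat x - lo)"]) (auto simp: of_nat_diff le_nat_iff nat_less_iff less_diff_conv2)
qed

lemma cell_vertex: "cell lo A B C u p \<Longrightarrow> u \<in> set (A @ B @ C)"
  by (auto elim!: cell.cases)

lemma vertex_cell: "u \<in> set (A @ B @ C) \<Longrightarrow> \<exists>p. cell lo A B C u p"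
  by (auto simp: in_set_conv_nth intro: cell.intros)

lemma cell_unique:
  assumes "distinct (A @ B @ C)" "cell lo A B C u p" "cell lo A B C u q"
  shows "p = q"
  using assms(2,3,1)
  by (elim cell.cases) (auto simp: nth_eq_iff_index_eq disjoint_iff dest: nth_mem)

lemma cell_inj:
  assumes "cell lo A B C u p" "cell lo A B C v p"
  shows "u = v"
  using assms by (elim cell.cases) auto

text \<open>\<open>H\<close> has an edge for every king's move between occupied cells. Then
  \<open>king_dist\<close> meets the hypotheses of \<open>strongly_resolvesI\<close>, with
  \<open>strip_descent\<close> providing the descent.\<close>

theorem strip_supergraph:
  assumes T: "pair_graph T" "connected T"
    and rows: "distinct (A @ B @ C)" "set (A @ B @ C) = pverts T"
    and lo: "1 \<le> lo" "lo \<le> length A" "lo \<le> length B"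
    and edges: "parcs T \<subseteq> strip_edges lo A B C"
  shows "\<exists>H. pair_graph H \<and> connected H \<and> pverts T = pverts H \<and> parcs T \<subseteq> parcs H
    \<and> strong_dimension H \<le> 2"
proof (intro exI conjI)
  define H where "H = \<lparr>pverts = pverts T, parcs = strip_edges lo A B C\<rparr>"
  define pos where "pos u = (THE p. cell lo A B C u p)" for u
  have pos: "pos u = p" if "cell lo A B C u p" for u p
    unfolding pos_def using that cell_unique[OF rows(1)] by (intro the_equality) auto
  have cell_pos: "cell lo A B C u (pos u)" if "u \<in> pverts T" for u
    using vertex_cell[of u A B C lo] that rows(2) pos by metis
  have vertex: "u \<in> pverts T" if "cell lo A B C u p" for u p
    using cell_vertex[OF that] by (simp only: rows(2))
  have arcs: "(u, v) \<in> parcs H \<longleftrightarrow> u \<in> pverts T \<and> v \<in> pverts T \<and> king_dist (pos u) (pos v) = 1" for u v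
  proof
    assume "(u, v) \<in> parcs H"
    then obtain p q where "cell lo A B C u p" "cell lo A B C v q" "king_dist p q = 1"
      by (auto simp: H_def strip_edges_def)
    then show "u \<in> pverts T \<and> v \<in> pverts T \<and> king_dist (pos u) (pos v) = 1"
      using vertex pos by metis
  next
    assume "u \<in> pverts T \<and> v \<in> pverts T \<and> king_dist (pos u) (pos v) = 1"
    then show "(u, v) \<in> parcs H"
      using cell_pos[of u] cell_pos[of v]
      by (simp only: H_def strip_edges_def pair_pre_digraph.simps mem_Collect_eq case_prod_conv) metis
  qed
  have sub: "pverts T = pverts H" "parcs T \<subseteq> parcs H" using edges by (simp_all add: H_def)
  have kd_refl: "king_dist p p = 0" for p
    by (simp add: king_dist_def)
  show H: "pair_graph H"
  proof (rule pair_graphI)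
    show "sym (parcs H)" by (rule symI) (simp only: arcs king_dist_commute)
    show "irrefl (parcs H)" by (rule irreflI) (simp add: arcs kd_refl)
    show "finite (pverts H)" using pair_graph_finite[OF T(1)] sub by simp
    show "parcs H \<subseteq> pverts H \<times> pverts H" using arcs sub by auto
  qed
  show "connected H"
    using T(2) sub(1) rtrancl_mono[OF sub(2)]
    unfolding connected_iff_rtrancl[OF T(1)] connected_iff_rtrancl[OF H] by auto
  show "pverts T = pverts H" "parcs T \<subseteq> parcs H" by fact+
  define a where "a = A ! 0"
  define b where "b = B ! 0"
  have a: "cell lo A B C a (0, 1)" and b: "cell lo A B C b (1, 0)"
    using cellA[of 0 A lo B C] cellB[of 0 B lo A C] lo unfolding a_def b_def by force+
  then have ab: "a \<in> pverts H" "b \<in> pverts H" "pos a = (0, 1)" "pos b = (1, 0)"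
    using vertex[OF a] vertex[OF b] sub(1) pos[OF a] pos[OF b] by simp_all
  have strip: "in_strip (int (length A)) (int (length B)) (int lo) (int (lo + length C)) (fst (pos u)) (snd (pos u))"
    if "u \<in> pverts H" for u
    using cell_pos[of u] that sub by (intro cell_in_strip) simp
  \<comment> \<open>Here \<open>1 \<le> lo\<close> matters: the cell \<open>(0, 0)\<close> would be
    at distance 1 from both vertices, against its coordinates.\<close>
  have dist_a: "int (king_dist (pos u) (pos a)) = fst (pos u)"
    and dist_b: "int (king_dist (pos u) (pos b)) = snd (pos u)" if "u \<in> pverts H" for u
    using strip[OF that] lo unfolding ab king_dist_def in_strip_def by auto
  have lip: "king_dist (pos x) (pos z) \<le> Suc (king_dist (pos y) (pos z))" if "(x, y) \<in> parcs H" for x y z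
    using that king_dist_triangle[of "pos x" "pos z" "pos y"] by (simp add: arcs)
  have descent: "\<exists>y. y \<in> pverts H \<and> (x, y) \<in> parcs H
      \<and> king_dist (pos x) (pos z) = Suc (king_dist (pos y) (pos z))"
    if xz: "x \<in> pverts H" "z \<in> pverts H" "x \<noteq> z" for x z
  proof -
    have ne: "pos x \<noteq> pos z"
      using xz cell_inj cell_pos sub by metis
    obtain r s where rs: "in_strip (int (length A)) (int (length B)) (int lo) (int (lo + length C)) r s"
      "max \<bar>fst (pos x) - r\<bar> \<bar>snd (pos x) - s\<bar> = 1"
      "max \<bar>fst (pos x) - fst (pos z)\<bar> \<bar>snd (pos x) - snd (pos z)\<bar>
        = 1 + max \<bar>r - fst (pos z)\<bar> \<bar>s - snd (pos z)\<bar>"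
      using strip_descent[OF _ _ _ strip[OF xz(1)] strip[OF xz(2)]] lo ne
      by (metis of_nat_1 of_nat_le_iff prod.collapse)
    obtain y where y: "cell lo A B C y (r, s)" using in_strip_cell[OF rs(1)] by auto
    have y': "y \<in> pverts T" "pos y = (r, s)" using vertex[OF y] pos[OF y] by simp_all
    moreover have "king_dist (pos x) (pos y) = 1"
      using rs(2) by (simp add: king_dist_def y'(2))
    moreover have "king_dist (pos x) (pos z) = Suc (king_dist (pos y) (pos z))"
      using rs(3) by (simp add: king_dist_def y'(2) nat_add_distrib)
    ultimately show ?thesis
      using xz(1) sub(1) unfolding arcs by auto
  qed
  have res: "strongly_resolves H w u v"
    if V: "u \<in> pverts H" "v \<in> pverts H" "w \<in> pverts H"
      and sum: "king_dist (pos u) (pos w) = king_dist (pos u) (pos v) + king_dist (pos v) (pos w)" for u v w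
    by (rule strongly_resolvesI[of H "\<lambda>x y. king_dist (pos x) (pos y)", OF lip kd_refl descent V sum])
  have "strong_resolving_set H {a, b}"
    unfolding strong_resolving_set_def
  proof (intro conjI ballI impI)
    fix u v assume uv: "u \<in> pverts H" "v \<in> pverts H"
    \<comment> \<open>The maximum metric is attained in one coordinate, so the distance of
      \<open>u\<close> and \<open>v\<close> is the difference of their distances from
      \<open>a\<close> or from \<open>b\<close>. The vertex nearer to that endpoint then lies on a
      shortest path from the other one.\<close>
    consider "int (king_dist (pos u) (pos v)) = fst (pos u) - fst (pos v)"
      | "int (king_dist (pos u) (pos v)) = fst (pos v) - fst (pos u)"
      | "int (king_dist (pos u) (pos v)) = snd (pos u) - snd (pos v)"
      | "int (king_dist (pos u) (pos v)) = snd (pos v) - snd (pos u)"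
      using king_dist_attained[of "pos u" "pos v"] by (simp only: insert_iff empty_iff) argo
    then show "\<exists>w \<in> {a, b}. strongly_resolves H w u v"
    proof cases
      case 1
      then have "strongly_resolves H a u v"
        using dist_a[OF uv(1)] dist_a[OF uv(2)] king_dist_commute[of "pos v" "pos u"]
        by (intro res[OF uv ab(1)]) linarith
      then show ?thesis using strongly_resolves_commute[of H a u v] by simp
    next
      case 2
      then have "strongly_resolves H a v u"
        using dist_a[OF uv(1)] dist_a[OF uv(2)] king_dist_commute[of "pos v" "pos u"]
        by (intro res[OF uv(2,1) ab(1)]) linarith
      then show ?thesis using strongly_resolves_commute[of H a u v] by simp
    next
      case 3
      then have "strongly_resolves H b u v"
        using dist_b[OF uv(1)] dist_b[OF uv(2)] king_dist_commute[of "pos v" "pos u"]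
        by (intro res[OF uv ab(2)]) linarith
      then show ?thesis using strongly_resolves_commute[of H b u v] by simp
    next
      case 4
      then have "strongly_resolves H b v u"
        using dist_b[OF uv(1)] dist_b[OF uv(2)] king_dist_commute[of "pos v" "pos u"]
        by (intro res[OF uv(2,1) ab(2)]) linarith
      then show ?thesis using strongly_resolves_commute[of H b u v] by simp
    qed
  qed (use ab in simp)
  then have "strong_dimension H \<le> card {a, b}" by (rule strong_dimension_le)
  also have "\<dots> \<le> 2" by (simp add: card_insert_le_m1)
  finally show "strong_dimension H \<le> 2" .
qed

section \<open>Laying out paths and caterpillars in a strip\<close>

definition path_edges :: "'a list \<Rightarrow> 'a rel" where
  "path_edges p = set (vwalk_arcs p) \<union> (set (vwalk_arcs p))\<inverse>"

lemma path_edges_simps [simp]: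
  "path_edges [] = {}"
  "path_edges [x] = {}"
  "path_edges (x # y # p) = {(x, y), (y, x)} \<union> path_edges (y # p)"
  by (auto simp: path_edges_def)

lemma path_edges_rev [simp]: "path_edges (rev p) = path_edges p"
  by (auto simp: path_edges_def set_vwalk_arcs_rev)

lemma path_edges_append:
  "path_edges (p @ x # q) = path_edges (p @ [x]) \<union> path_edges (x # q)"
proof (induction p rule: list.induct)
  case (Cons y p)
  then show ?case by (cases p) auto
qed simp

lemma strip_edgesI:
  "cell lo A B C u p \<Longrightarrow> cell lo A B C v q \<Longrightarrow> king_dist p q = 1 \<Longrightarrow> {(u, v), (v, u)} \<subseteq> strip_edges lo A B C"
  unfolding strip_edges_def using king_dist_commute[of p q]
  by (simp only: insert_subset mem_Collect_eq case_prod_conv empty_subsetI) metis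

text \<open>Rows grow only at their upper ends, so vertices already placed keep their cells. This
  allows a layout to be built piece by piece.\<close>

lemma cell_append:
  "cell lo A B C u p \<Longrightarrow> cell lo (A @ A') (B @ B') (C @ C') u p"
  by (elim cell.cases) (metis cell.intros nth_append length_append trans_less_add1)+

lemma strip_edges_append:
  "strip_edges lo A B C \<subseteq> strip_edges lo (A @ A') (B @ B') (C @ C')"
  unfolding strip_edges_def using cell_append by fast

lemma cell_swap: "cell lo A B C u (x, y) \<longleftrightarrow> cell lo B A C u (y, x)"
  by (auto elim!: cell.cases intro: cell.intros)

text \<open>Reflection in the diagonal, by which facts about row \<open>B\<close> follow from those
  about row \<open>A\<close>.\<close>

lemma strip_edges_swap: "strip_edges lo A B C = strip_edges lo B A C"
proof -
  have "strip_edges lo A B C \<subseteq> strip_edges lo B A C" for A B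
  proof
    fix e assume "e \<in> strip_edges lo A B C"
    then obtain u v x y z w where "e = (u, v)" "cell lo A B C u (x, y)" "cell lo A B C v (z, w)"
      "king_dist (x, y) (z, w) = 1" by (auto simp: strip_edges_def)
    then have "cell lo B A C u (y, x)" "cell lo B A C v (w, z)" "king_dist (y, x) (w, z) = 1"
      by (simp_all add: cell_swap[of lo B] king_dist_def max.commute)
    with \<open>e = (u, v)\<close> show "e \<in> strip_edges lo B A C"
      unfolding strip_edges_def by blast
  qed
  then show ?thesis by blast
qed

section \<open>Placing vertices on free cells\<close>

lemma cell_snocA: "cell lo (A @ [v]) B C v (int (length A), int (length A) + 1)"
  using cellA[of "length A" "A @ [v]"] by simp

lemma cell_snocB: "cell lo A (B @ [v]) C v (int (length B) + 1, int (length B))"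
  using cellB[of "length B" "B @ [v]"] by simp

lemma cell_snocC: "cell lo A B (C @ [v]) v (int (lo + length C), int (lo + length C))"
  using cellC[of "length C" "C @ [v]"] by simp

lemma path_along_cells:
  assumes "\<And>i. i < length p \<Longrightarrow> cell lo A B C (p ! i) (f i)"
    and "\<And>i. Suc i < length p \<Longrightarrow> king_dist (f i) (f (Suc i)) = 1"
  shows "path_edges p \<subseteq> strip_edges lo A B C"
  using assms
proof (induction p arbitrary: f rule: induct_list012)
  case (3 x y p)
  have "path_edges (y # p) \<subseteq> strip_edges lo A B C"
    using 3(3)[of "Suc _"] 3(4)[of "Suc _"] by (intro 3(2)[of "\<lambda>i. f (Suc i)"]) simp_all
  moreover have "{(x, y), (y, x)} \<subseteq> strip_edges lo A B C"
    using 3(3)[of 0] 3(3)[of 1] 3(4)[of 0] by (intro strip_edgesI[of _ _ _ _ _ "f 0" _ "f 1"]) simp_all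
  ultimately show ?case by simp
qed simp_all

text \<open>The leg runs straight up row \<open>A\<close>, so only the step from \<open>z\<close> to
  the first free cell of that row has to be checked.\<close>

lemma attach_legA:
  assumes "cell lo A B C z p" "king_dist p (int (length A), int (length A) + 1) = 1"
  shows "path_edges (z # u) \<subseteq> strip_edges lo (A @ u) B C"
proof (cases u)
  case (Cons v u')
  have "path_edges u \<subseteq> strip_edges lo (A @ u) B C"
  proof (rule path_along_cells)
    show "cell lo (A @ u) B C (u ! i) (int (length A) + int i, int (length A) + int i + 1)"
      if "i < length u" for i
      using cellA[of "length A + i" "A @ u" lo B C] that by simp
  qed (simp add: king_dist_def)
  moreover have "{(z, v), (v, z)} \<subseteq> strip_edges lo (A @ u) B C"
  proof (rule strip_edgesI)
    show "cell lo (A @ u) B C z p" using cell_append[OF assms(1), of u "[]" "[]"] by simp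
    show "cell lo (A @ u) B C v (int (length A), int (length A) + 1)"
      using cell_append[OF cell_snocA[of lo A v B C], of u' "[]" "[]"] by (simp add: Cons)
  qed fact
  ultimately show ?thesis by (simp add: Cons)
qed simp

lemma attach_legB:
  assumes "cell lo A B C z p" "king_dist p (int (length B) + 1, int (length B)) = 1"
  shows "path_edges (z # u) \<subseteq> strip_edges lo A (B @ u) C"
proof -
  obtain x y where "p = (x, y)" by (cases p)
  then show ?thesis
    using attach_legA[of lo B A C z "(y, x)" u] assms
    by (simp add: strip_edges_swap[of lo A] cell_swap[of lo A] king_dist_def max.commute)
qed

lemma attach_legC:
  assumes "cell lo A B C z p" "king_dist p (int (lo + length C), int (lo + length C)) = 1"
  shows "path_edges (z # u) \<subseteq> strip_edges lo A B (C @ u)"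
proof (cases u)
  case (Cons v u')
  have "path_edges u \<subseteq> strip_edges lo A B (C @ u)"
  proof (rule path_along_cells)
    show "cell lo A B (C @ u) (u ! i) (int (lo + length C) + int i, int (lo + length C) + int i)"
      if "i < length u" for i
      using cellC[of "length C + i" "C @ u" lo A B] that by (simp add: add.assoc)
  qed (simp add: king_dist_def)
  moreover have "{(z, v), (v, z)} \<subseteq> strip_edges lo A B (C @ u)"
  proof (rule strip_edgesI)
    show "cell lo A B (C @ u) z p" using cell_append[OF assms(1), of "[]" "[]" u] by simp
    show "cell lo A B (C @ u) v (int (lo + length C), int (lo + length C))"
      using cell_append[OF cell_snocC[of lo A B C v], of "[]" "[]" u'] by (simp add: Cons)
  qed fact
  ultimately show ?thesis by (simp add: Cons)
qed simp

text \<open>Greedy placement: \<open>P\<close> is an invariant of the row lengths and the current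
  cell, and \<open>step\<close> finds a row whose first free cell is a king's move away and
  preserves it. Only the multiset of the placed vertices is recorded, not their order.\<close>

lemma lay_path:
  assumes step: "\<And>a b c p. P a b c p \<Longrightarrow>
      king_dist p (int a, int a + 1) = 1 \<and> P (Suc a) b c (int a, int a + 1)
    \<or> king_dist p (int b + 1, int b) = 1 \<and> P a (Suc b) c (int b + 1, int b)
    \<or> king_dist p (int (lo + c), int (lo + c)) = 1 \<and> P a b (Suc c) (int (lo + c), int (lo + c))"
    and "cell lo A B C z p" "P (length A) (length B) (length C) p"
  shows "\<exists>A' B' C' q. mset A' + mset B' + mset C' = mset s
    \<and> path_edges (z # s) \<subseteq> strip_edges lo (A @ A') (B @ B') (C @ C')
    \<and> cell lo (A @ A') (B @ B') (C @ C') (last (z # s)) q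
    \<and> P (length (A @ A')) (length (B @ B')) (length (C @ C')) q"
  using assms(2,3)
proof (induction s arbitrary: A B C z p rule: list.induct)
  case Nil
  then show ?case by (intro exI[of _ "[]"] exI[of _ p]) simp
next
  case (Cons v s)
  obtain X Y Z q where q: "mset X + mset Y + mset Z = {#v#}" "king_dist p q = 1"
    "cell lo (A @ X) (B @ Y) (C @ Z) v q"
    "P (length (A @ X)) (length (B @ Y)) (length (C @ Z)) q"
    using step[OF Cons.prems(2)]
  proof (elim disjE conjE)
    assume "king_dist p (int (length A), int (length A) + 1) = 1"
      "P (Suc (length A)) (length B) (length C) (int (length A), int (length A) + 1)"
    then show ?thesis using cell_snocA[of lo A v B C] by (intro that[of "[v]" "[]" "[]"]) simp_all
  next
    assume "king_dist p (int (length B) + 1, int (length B)) = 1"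
      "P (length A) (Suc (length B)) (length C) (int (length B) + 1, int (length B))"
    then show ?thesis using cell_snocB[of lo A B v C] by (intro that[of "[]" "[v]" "[]"]) simp_all
  next
    assume "king_dist p (int (lo + length C), int (lo + length C)) = 1"
      "P (length A) (length B) (Suc (length C)) (int (lo + length C), int (lo + length C))"
    then show ?thesis using cell_snocC[of lo A B C v] by (intro that[of "[]" "[]" "[v]"]) simp_all
  qed
  obtain A' B' C' r where r: "mset A' + mset B' + mset C' = mset s"
    "path_edges (v # s) \<subseteq> strip_edges lo ((A @ X) @ A') ((B @ Y) @ B') ((C @ Z) @ C')"
    "cell lo ((A @ X) @ A') ((B @ Y) @ B') ((C @ Z) @ C') (last (v # s)) r"
    "P (length ((A @ X) @ A')) (length ((B @ Y) @ B')) (length ((C @ Z) @ C')) r"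
    using Cons.IH[OF q(3,4)] by blast
  have "{(z, v), (v, z)} \<subseteq> strip_edges lo ((A @ X) @ A') ((B @ Y) @ B') ((C @ Z) @ C')"
    using cell_append[OF cell_append[OF Cons.prems(1)]] cell_append[OF q(3)] q(2)
    by (rule strip_edgesI)
  moreover have "mset (X @ A') + mset (Y @ B') + mset (Z @ C') = mset (v # s)"
    using q(1) r(1) by (simp add: ac_simps)
  ultimately show ?case
    using r(2-4) by (intro exI[of _ "X @ A'"] exI[of _ "Y @ B'"] exI[of _ "Z @ C'"] exI[of _ r]) simp
qed

text \<open>\<open>snake_top n a b p\<close> describes the filling reached by the path through the cells
  \<open>(j, j), (j, j + 1), (j + 1, j), (j + 1, j + 1), \<dots>\<close> when it stops at \<open>p\<close>, where
  \<open>(n, n)\<close> is the first free cell of the middle row.\<close>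

definition snake_top :: "int \<Rightarrow> int \<Rightarrow> int \<Rightarrow> int \<times> int \<Rightarrow> bool" where
  "snake_top n a b p \<longleftrightarrow> p = (n - 1, n - 1) \<and> a = n - 1 \<and> b = n - 1
    \<or> p = (n - 1, n) \<and> a = n \<and> b = n - 1 \<or> p = (n, n - 1) \<and> a = n \<and> b = n"

text \<open>The same for a path that alternates between the middle row and row \<open>B\<close> only; in the last
  case it has not started yet.\<close>

definition zigzag_top :: "int \<Rightarrow> int \<Rightarrow> int \<times> int \<Rightarrow> bool" where
  "zigzag_top n b p \<longleftrightarrow> p = (n - 1, n - 1) \<and> b = n - 1
    \<or> p = (n, n - 1) \<and> b = n \<or> p = (n - 1, n) \<and> b = n - 1"

text \<open>The rows are visited in the cyclic order \<open>A\<close>, \<open>B\<close>, middle. The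
  crossing from \<open>(n - 1, n)\<close> to \<open>(n, n - 1)\<close> is a diagonal king's
  move.\<close>

lemma lay_snake:
  assumes "cell lo A B C z p" "snake_top (int (lo + length C)) (int (length A)) (int (length B)) p"
  shows "\<exists>A' B' C' q. mset A' + mset B' + mset C' = mset s
    \<and> path_edges (z # s) \<subseteq> strip_edges lo (A @ A') (B @ B') (C @ C')
    \<and> cell lo (A @ A') (B @ B') (C @ C') (last (z # s)) q
    \<and> snake_top (int (lo + length (C @ C'))) (int (length (A @ A'))) (int (length (B @ B'))) q"
proof (rule lay_path[where P = "\<lambda>a b c p. snake_top (int (lo + c)) (int a) (int b) p", OF _ assms])
  fix a b c and p :: "int \<times> int"
  assume "snake_top (int (lo + c)) (int a) (int b) p"
  then show "king_dist p (int a, int a + 1) = 1 \<and> snake_top (int (lo + c)) (int (Suc a)) (int b) (int a, int a + 1)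
    \<or> king_dist p (int b + 1, int b) = 1 \<and> snake_top (int (lo + c)) (int a) (int (Suc b)) (int b + 1, int b)
    \<or> king_dist p (int (lo + c), int (lo + c)) = 1
      \<and> snake_top (int (lo + Suc c)) (int a) (int b) (int (lo + c), int (lo + c))"
    unfolding snake_top_def by (elim disjE conjE) (simp_all add: king_dist_def)
qed

text \<open>The invariant leaves the length of row \<open>A\<close> open, so that row may already
  hold a leg.\<close>

lemma lay_zigzag:
  assumes "cell lo A B C z p" "zigzag_top (int (lo + length C)) (int (length B)) p"
  shows "\<exists>A' B' C' q. mset A' + mset B' + mset C' = mset s
    \<and> path_edges (z # s) \<subseteq> strip_edges lo (A @ A') (B @ B') (C @ C')
    \<and> cell lo (A @ A') (B @ B') (C @ C') (last (z # s)) q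
    \<and> zigzag_top (int (lo + length (C @ C'))) (int (length (B @ B'))) q"
proof (rule lay_path[where P = "\<lambda>a b c p. zigzag_top (int (lo + c)) (int b) p", OF _ assms])
  fix a b c and p :: "int \<times> int"
  assume "zigzag_top (int (lo + c)) (int b) p"
  then show "king_dist p (int a, int a + 1) = 1 \<and> zigzag_top (int (lo + c)) (int b) (int a, int a + 1)
    \<or> king_dist p (int b + 1, int b) = 1 \<and> zigzag_top (int (lo + c)) (int (Suc b)) (int b + 1, int b)
    \<or> king_dist p (int (lo + c), int (lo + c)) = 1
      \<and> zigzag_top (int (lo + Suc c)) (int b) (int (lo + c), int (lo + c))"
    unfolding zigzag_top_def by (elim disjE conjE) (simp_all add: king_dist_def)
qed

text \<open>In every state of \<open>zigzag_top\<close> the first free cells of row \<open>B\<close>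
  and of the middle row are both neighbours of the current cell, so the two legs can run straight up
  these rows.\<close>

lemma lay_fork:
  assumes "cell lo A B C z p" "zigzag_top (int (lo + length C)) (int (length B)) p"
  shows "\<exists>A' B' C'. mset A' + mset B' + mset C' = mset (s @ u @ v)
    \<and> path_edges (z # s) \<union> path_edges (last (z # s) # u) \<union> path_edges (last (z # s) # v)
      \<subseteq> strip_edges lo (A @ A') (B @ B') (C @ C')"
proof -
  obtain A' B' C' q where *: "mset A' + mset B' + mset C' = mset s"
    "path_edges (z # s) \<subseteq> strip_edges lo (A @ A') (B @ B') (C @ C')"
    "cell lo (A @ A') (B @ B') (C @ C') (last (z # s)) q"
    "zigzag_top (int (lo + length (C @ C'))) (int (length (B @ B'))) q"
    using lay_zigzag[OF assms, of s] by blast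
  have "path_edges (last (z # s) # u) \<subseteq> strip_edges lo (A @ A') ((B @ B') @ u) (C @ C')"
    using *(4) by (intro attach_legB[OF *(3)]) (auto simp: zigzag_top_def king_dist_def)
  moreover have "path_edges (last (z # s) # v) \<subseteq> strip_edges lo (A @ A') (B @ B') ((C @ C') @ v)"
    using *(4) by (intro attach_legC[OF *(3)]) (auto simp: zigzag_top_def king_dist_def)
  ultimately have "path_edges (z # s) \<union> path_edges (last (z # s) # u) \<union> path_edges (last (z # s) # v)
      \<subseteq> strip_edges lo (A @ A') ((B @ B') @ u) ((C @ C') @ v)"
    using *(2) strip_edges_append[of lo "A @ A'" "B @ B'" "C @ C'" "[]" u v]
      strip_edges_append[of lo "A @ A'" "(B @ B') @ u" "C @ C'" "[]" "[]" v]
      strip_edges_append[of lo "A @ A'" "B @ B'" "(C @ C') @ v" "[]" u "[]"]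
    unfolding append_Nil2 by blast
  then show ?thesis
    using *(1) by (intro exI[of _ A'] exI[of _ "B' @ u"] exI[of _ "C' @ v"]) (auto simp: ac_simps)
qed

text \<open>If the snake stops in the middle row or in row \<open>A\<close>, the first free cells of
  all three rows are within reach: \<open>L3\<close> takes row \<open>A\<close> and the rest zigzags
  through the others. If it stops in row \<open>B\<close>, the first free cell of row
  \<open>A\<close> is two moves away, and the side rows exchange their roles.\<close>

lemma lay_upper:
  assumes c1: "cell lo A B C c1 p"
    and top: "snake_top (int (lo + length C)) (int (length A)) (int (length B)) p"
    and s2: "s2 \<noteq> [] \<or> s1 = [] \<and> p = (int (lo + length C) - 1, int (lo + length C) - 1)"
  shows "\<exists>A' B' C'. mset A' + mset B' + mset C' = mset (s1 @ L3 @ s2 @ L4 @ L5)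
    \<and> path_edges (c1 # s1) \<union> path_edges (last (c1 # s1) # L3) \<union> path_edges (last (c1 # s1) # s2)
      \<union> path_edges (last (last (c1 # s1) # s2) # L4) \<union> path_edges (last (last (c1 # s1) # s2) # L5)
      \<subseteq> strip_edges lo (A @ A') (B @ B') (C @ C')"
proof -
  obtain A' B' C' q where *: "mset A' + mset B' + mset C' = mset s1"
    "path_edges (c1 # s1) \<subseteq> strip_edges lo (A @ A') (B @ B') (C @ C')"
    "cell lo (A @ A') (B @ B') (C @ C') (last (c1 # s1)) q"
    "snake_top (int (lo + length (C @ C'))) (int (length (A @ A'))) (int (length (B @ B'))) q"
    \<comment> \<open>An empty \<open>s1\<close> leaves the current cell at \<open>p\<close>. If
      \<open>p\<close> is in the middle row, this excludes the case \<open>side\<close>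
      below.\<close>
    and q_middle: "s1 = [] \<Longrightarrow> p = (int (lo + length C) - 1, int (lo + length C) - 1)
      \<Longrightarrow> q = (int (lo + length (C @ C')) - 1, int (lo + length (C @ C')) - 1)"
  proof (cases "s1 = []")
    case True
    then show ?thesis using that[of "[]" "[]" "[]" p] c1 top by simp
  next
    case False
    then show ?thesis using that lay_snake[OF c1 top, of s1] by blast
  qed
  define A1 where "A1 = A @ A'"
  define B1 where "B1 = B @ B'"
  define C1 where "C1 = C @ C'"
  define n where "n = int (lo + length C1)"
  define c2 where "c2 = last (c1 # s1)"
  have c2: "cell lo A1 B1 C1 c2 q" and edges: "path_edges (c1 # s1) \<subseteq> strip_edges lo A1 B1 C1"
    using * by (simp_all add: A1_def B1_def C1_def c2_def)
  have "\<exists>X Y Z. mset X + mset Y + mset Z = mset (L3 @ s2 @ L4 @ L5)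
    \<and> path_edges (c2 # L3) \<union> path_edges (c2 # s2)
      \<union> path_edges (last (c2 # s2) # L4) \<union> path_edges (last (c2 # s2) # L5)
      \<subseteq> strip_edges lo (A1 @ X) (B1 @ Y) (C1 @ Z)"
  proof -
    consider (zigzag) "zigzag_top n (int (length B1)) q" "king_dist q (int (length A1), int (length A1) + 1) = 1"
      | (side) "q = (n, n - 1)" "int (length A1) = n" "int (length B1) = n"
      using *(4) unfolding snake_top_def zigzag_top_def A1_def[symmetric] B1_def[symmetric]
        C1_def[symmetric] n_def[symmetric] by (elim disjE conjE) (simp_all add: king_dist_def)
    then show ?thesis
    proof cases
      case zigzag
      have c2': "cell lo (A1 @ L3) B1 C1 c2 q" using cell_append[OF c2, of L3 "[]" "[]"] by simp
      obtain X Y Z where XYZ: "mset X + mset Y + mset Z = mset (s2 @ L4 @ L5)"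
        "path_edges (c2 # s2) \<union> path_edges (last (c2 # s2) # L4) \<union> path_edges (last (c2 # s2) # L5)
          \<subseteq> strip_edges lo ((A1 @ L3) @ X) (B1 @ Y) (C1 @ Z)"
        using lay_fork[OF c2' zigzag(1)[unfolded n_def], of s2 L4 L5] by blast
      moreover have "path_edges (c2 # L3) \<subseteq> strip_edges lo ((A1 @ L3) @ X) (B1 @ Y) (C1 @ Z)"
        using attach_legA[OF c2 zigzag(2), of L3] strip_edges_append[of lo "A1 @ L3" B1 C1 X Y Z] by blast
      ultimately show ?thesis
        by (intro exI[of _ "L3 @ X"] exI[of _ Y] exI[of _ Z]) (auto simp: ac_simps)
    next
      case side
      \<comment> \<open>Only two first free cells are within reach here, too few for three legs at
        \<open>c2\<close>.\<close>
      then have "s2 \<noteq> []"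
        using s2 q_middle by (auto simp: n_def C1_def)
      then obtain v s where v: "s2 = v # s" by (cases s2) auto
      \<comment> \<open>The first vertex of \<open>s2\<close> moves to the middle cell
        \<open>(n, n)\<close>. From there the zigzag uses the middle row and row \<open>A\<close>,
        while \<open>L3\<close> occupies row \<open>B\<close>.\<close>
      have edge: "{(c2, v), (v, c2)} \<subseteq> strip_edges lo A1 (B1 @ L3) (C1 @ [v])"
        using cell_append[OF c2, of "[]" L3 "[v]"] cell_snocC[of lo A1 "B1 @ L3" C1 v] side(1)
        by (intro strip_edgesI[of _ _ _ _ _ q _ "(n, n)"]) (simp_all add: n_def king_dist_def)
      have v_cell: "cell lo (B1 @ L3) A1 (C1 @ [v]) v (n, n)"
        using cell_snocC[of lo "B1 @ L3" A1 C1 v] by (simp add: n_def)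
      have v_top: "zigzag_top (int (lo + length (C1 @ [v]))) (int (length A1)) (n, n)"
        using side(2) by (simp add: zigzag_top_def n_def)
      obtain Y X Z where XYZ: "mset Y + mset X + mset Z = mset (s @ L4 @ L5)"
        "path_edges (v # s) \<union> path_edges (last (v # s) # L4) \<union> path_edges (last (v # s) # L5)
          \<subseteq> strip_edges lo ((B1 @ L3) @ Y) (A1 @ X) ((C1 @ [v]) @ Z)"
        using lay_fork[OF v_cell v_top, of s L4 L5] by blast
      have "path_edges (c2 # L3) \<subseteq> strip_edges lo A1 (B1 @ L3) C1"
        using side(1,3) by (intro attach_legB[OF c2]) (simp add: king_dist_def)
      then have "path_edges (c2 # L3) \<subseteq> strip_edges lo (A1 @ X) ((B1 @ L3) @ Y) ((C1 @ [v]) @ Z)"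
        using strip_edges_append[of lo A1 "B1 @ L3" C1 X Y "[v] @ Z"] by (simp add: subset_iff)
      moreover have "{(c2, v), (v, c2)} \<subseteq> strip_edges lo (A1 @ X) ((B1 @ L3) @ Y) ((C1 @ [v]) @ Z)"
        using edge strip_edges_append by (rule subset_trans)
      ultimately show ?thesis
        using XYZ by (intro exI[of _ X] exI[of _ "L3 @ Y"] exI[of _ "v # Z"])
          (auto simp: ac_simps v strip_edges_swap[of lo "A1 @ X"])
    qed
  qed
  then obtain X Y Z where XYZ: "mset X + mset Y + mset Z = mset (L3 @ s2 @ L4 @ L5)"
    "path_edges (c2 # L3) \<union> path_edges (c2 # s2)
      \<union> path_edges (last (c2 # s2) # L4) \<union> path_edges (last (c2 # s2) # L5)
      \<subseteq> strip_edges lo (A1 @ X) (B1 @ Y) (C1 @ Z)" by blast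
  have "path_edges (c1 # s1) \<subseteq> strip_edges lo (A1 @ X) (B1 @ Y) (C1 @ Z)"
    using edges strip_edges_append by (rule subset_trans)
  moreover have "mset (A' @ X) + mset (B' @ Y) + mset (C' @ Z) = mset (s1 @ L3 @ s2 @ L4 @ L5)"
  proof -
    have "mset (A' @ X) + mset (B' @ Y) + mset (C' @ Z) = mset s1 + mset (L3 @ s2 @ L4 @ L5)"
      unfolding *(1)[symmetric] XYZ(1)[symmetric] by (simp add: ac_simps)
    then show ?thesis by simp
  qed
  ultimately show ?thesis
    using XYZ(2) unfolding c2_def[symmetric] A1_def B1_def C1_def
    by (intro exI[of _ "A' @ X"] exI[of _ "B' @ Y"] exI[of _ "C' @ Z"]) simp
qed

text \<open>The two legs bend around the bottom of the strip, so that together with \<open>c1\<close> they occupy a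
  cycle of the king's graph. The two side rows alone only provide even cycles, with \<open>c1\<close> on top of
  row \<open>B\<close>; an odd one has \<open>c1\<close> in the middle row, which leaves three free cells above it.\<close>

lemma lay_bottom:
  assumes "L1 \<noteq> []" "L2 \<noteq> []"
  shows "\<exists>lo A B C p. mset A + mset B + mset C = mset (c1 # L1 @ L2)
    \<and> 1 \<le> lo \<and> lo \<le> length A \<and> lo \<le> length B
    \<and> path_edges (c1 # L1) \<union> path_edges (c1 # L2) \<subseteq> strip_edges lo A B C
    \<and> cell lo A B C c1 p \<and> snake_top (int (lo + length C)) (int (length A)) (int (length B)) p
    \<and> (even (length L1 + length L2) \<longrightarrow> p = (int (lo + length C) - 1, int (lo + length C) - 1))"
proof -
  \<comment> \<open>\<open>c1 # M @ [c1]\<close> is the closed walk out along \<open>L1\<close> and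
    back along \<open>L2\<close>; laying it out yields one extra edge between the ends of the legs,
    which does no harm.\<close>
  define M where "M = L1 @ rev L2"
  define m where "m = length M div 2"
  have len: "length M = length L1 + length L2" by (simp add: M_def)
  moreover have "length L1 \<noteq> 0" "length L2 \<noteq> 0" using assms by simp_all
  ultimately have len2: "2 \<le> length M" by linarith
  have mid: "(c1 # M @ [c1]) ! i = M ! (i - 1)" if "i \<noteq> 0" "i \<le> length M" for i
    using that by (cases i) (simp_all add: nth_append)
  have sub: "path_edges (c1 # L1) \<union> path_edges (c1 # L2) \<subseteq> path_edges (c1 # M @ [c1])"
  proof -
    obtain y r where r: "rev L2 = y # r" using assms(2) by (cases "rev L2") auto
    then have "y # (r @ [c1]) = rev (c1 # L2)" by simp
    moreover have "c1 # M @ [c1] = (c1 # L1) @ y # (r @ [c1])" by (simp add: M_def r)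
    ultimately have "path_edges (c1 # L2) \<subseteq> path_edges (c1 # M @ [c1])"
      using path_edges_append[of "c1 # L1" y "r @ [c1]"] path_edges_rev[of "c1 # L2"] by (metis Un_upper2)
    moreover have "path_edges (c1 # L1) \<subseteq> path_edges (c1 # M @ [c1])"
      unfolding path_edges_def M_def using set_vwalk_arcs_append1[of "c1 # L1" "rev L2 @ [c1]"] by auto
    ultimately show ?thesis by blast
  qed
  show ?thesis
  proof (cases "even (length M)")
    case True
    then have m: "length M = 2 * m" "1 \<le> m" using len2 by (auto simp: m_def)
    \<comment> \<open>The cycle descends row \<open>A\<close> from \<open>(m - 1, m)\<close> to
      \<open>(0, 1)\<close>, crosses to \<open>(1, 0)\<close>, ascends row \<open>B\<close> to
      \<open>(m, m - 1)\<close> and returns to \<open>c1\<close> at \<open>(m, m)\<close>. The cell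
      at position \<open>i\<close> of the cycle is \<open>f i\<close>.\<close>
    define A where "A = rev (take m M)"
    define B where "B = drop m M"
    define f where "f i = (if i = 0 \<or> i = 2 * m + 1 then (int m, int m)
      else if i \<le> m then (int (m - i), int (m - i) + 1) else (int (i - m - 1) + 1, int (i - m - 1)))" for i
    have f: "f 0 = (int m, int m)" "f (2 * m + 1) = (int m, int m)"
      "\<And>i. i \<noteq> 0 \<Longrightarrow> i \<le> m \<Longrightarrow> f i = (int (m - i), int (m - i) + 1)"
      "\<And>i. m < i \<Longrightarrow> i < 2 * m + 1 \<Longrightarrow> f i = (int (i - m - 1) + 1, int (i - m - 1))"
      by (simp_all add: f_def)
    have lens: "length A = m" "length B = m" by (simp_all add: A_def B_def m)
    have "cell m A B [c1] ((c1 # M @ [c1]) ! i) (f i)" if i: "i < length (c1 # M @ [c1])" for i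
    proof -
      have "i < 2 * m + 1 \<or> i = 2 * m + 1" using i m by auto
      then consider "i = 0 \<or> i = 2 * m + 1" | "i \<noteq> 0" "i \<le> m" | "m < i" "i < 2 * m + 1"
        using not_le[of i m] by blast
      then show ?thesis
      proof cases
        case 1
        then show ?thesis using cellC[of 0 "[c1]" m A B] m(1) f(1,2) by (elim disjE) (simp_all add: nth_append)
      next
        case 2
        then have "A ! (m - i) = M ! (i - 1)" using m by (simp add: A_def rev_nth)
        then show ?thesis using cellA[of "m - i" A m B "[c1]"] 2 m lens f(3)[of i] mid[of i]
          by simp
      next
        case 3
        then have "B ! (i - m - 1) = M ! (i - 1)" using m by (simp add: B_def)
        then show ?thesis using cellB[of "i - m - 1" B m A "[c1]"] 3 m lens f(4)[of i] mid[of i]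
          by simp
      qed
    qed
    moreover have "king_dist (f i) (f (Suc i)) = 1" if i: "Suc i < length (c1 # M @ [c1])" for i
    proof -
      have top: "Suc i < 2 * m + 1 \<or> Suc i = 2 * m + 1" using i m by auto
      consider "i = 0" "m = 0" | "i = 0" "m \<noteq> 0" | "i \<noteq> 0" "i < m" | "i \<noteq> 0" "i = m"
        | "m < i" "Suc i < 2 * m + 1" | "m < i" "Suc i = 2 * m + 1"
        using top nat_neq_iff[of i m] by blast
      then show ?thesis
      proof cases
        case 1
        then show ?thesis using f(1) f(4)[of "Suc i"] m by (simp add: king_dist_def)
      next
        case 2
        then show ?thesis using f(1) f(3)[of "Suc i"] by (simp add: king_dist_def of_nat_diff)
      next
        case 3
        then show ?thesis using f(3)[of i] f(3)[of "Suc i"] by (simp add: king_dist_def of_nat_diff)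
      next
        case 4
        then show ?thesis using f(3)[of i] f(4)[of "Suc i"] by (simp add: king_dist_def of_nat_diff)
      next
        case 5
        then show ?thesis using f(4)[of i] f(4)[of "Suc i"] by (simp add: king_dist_def of_nat_diff)
      next
        case 6
        then show ?thesis using f(2) f(4)[of i] by (simp add: king_dist_def of_nat_diff)
      qed
    qed
    ultimately have "path_edges (c1 # M @ [c1]) \<subseteq> strip_edges m A B [c1]"
      by (rule path_along_cells)
    with sub have "path_edges (c1 # L1) \<union> path_edges (c1 # L2) \<subseteq> strip_edges m A B [c1]"
      by (rule subset_trans)
    moreover have "mset A + mset B + mset [c1] = mset (c1 # L1 @ L2)"
    proof -
      have "mset (take m M) + mset (drop m M) = mset M"
        by (metis append_take_drop_id mset_append)
      then show ?thesis by (simp add: A_def B_def) (simp add: M_def)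
    qed
    moreover have "cell m A B [c1] c1 (int m, int m)" using cellC[of 0 "[c1]" m A B] by simp
    moreover have "snake_top (int (m + length [c1])) (int (length A)) (int (length B)) (int m, int m)"
      by (simp add: snake_top_def lens)
    ultimately show ?thesis
      using m(2) lens
      by (intro exI[of _ m] exI[of _ A] exI[of _ B] exI[of _ "[c1]"] exI[of _ "(int m, int m)"] conjI)
        simp_all
  next
    case False
    then have m: "length M = 2 * m + 1" by (simp add: m_def)
    \<comment> \<open>Now \<open>c1\<close> is the top cell \<open>(m + 1, m)\<close> of row
      \<open>B\<close>. The cycle descends this row, crosses to row \<open>A\<close> and ascends to
      \<open>(m, m + 1)\<close>, a diagonal king's move from \<open>c1\<close>; the middle row stays
      empty.\<close>
    define A where "A = drop m M"
    define B where "B = rev (take m M) @ [c1]"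
    define f where "f i = (if i = 0 \<or> i = 2 * m + 2 then (int m + 1, int m)
      else if i \<le> m then (int (m - i) + 1, int (m - i)) else (int (i - m - 1), int (i - m - 1) + 1))" for i
    have f: "f 0 = (int m + 1, int m)" "f (2 * m + 2) = (int m + 1, int m)"
      "\<And>i. i \<noteq> 0 \<Longrightarrow> i \<le> m \<Longrightarrow> f i = (int (m - i) + 1, int (m - i))"
      "\<And>i. m < i \<Longrightarrow> i < 2 * m + 2 \<Longrightarrow> f i = (int (i - m - 1), int (i - m - 1) + 1)"
      by (simp_all add: f_def)
    have lens: "length A = m + 1" "length B = m + 1" by (simp_all add: A_def B_def m)
    have c1: "cell (m + 1) A B [] c1 (int m + 1, int m)"
      using cellB[of m B "m + 1" A "[]"] by (simp add: B_def m nth_append)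
    have "cell (m + 1) A B [] ((c1 # M @ [c1]) ! i) (f i)" if i: "i < length (c1 # M @ [c1])" for i
    proof -
      have "i < 2 * m + 2 \<or> i = 2 * m + 2" using i m by auto
      then consider "i = 0 \<or> i = 2 * m + 2" | "i \<noteq> 0" "i \<le> m" | "m < i" "i < 2 * m + 2"
        using not_le[of i m] by blast
      then show ?thesis
      proof cases
        case 1
        then show ?thesis using c1 m f(1,2) by (elim disjE) (simp_all add: nth_append)
      next
        case 2
        then have "B ! (m - i) = M ! (i - 1)" using m by (simp add: B_def rev_nth nth_append)
        then show ?thesis using cellB[of "m - i" B "m + 1" A "[]"] 2 m lens f(3)[of i] mid[of i]
          by simp
      next
        case 3
        then have "A ! (i - m - 1) = M ! (i - 1)" using m by (simp add: A_def)
        then show ?thesis using cellA[of "i - m - 1" A "m + 1" B "[]"] 3 m lens f(4)[of i] mid[of i]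
          by simp
      qed
    qed
    moreover have "king_dist (f i) (f (Suc i)) = 1" if i: "Suc i < length (c1 # M @ [c1])" for i
    proof -
      have top: "Suc i < 2 * m + 2 \<or> Suc i = 2 * m + 2" using i m by auto
      consider "i = 0" "m = 0" | "i = 0" "m \<noteq> 0" | "i \<noteq> 0" "i < m" | "i \<noteq> 0" "i = m"
        | "m < i" "Suc i < 2 * m + 2" | "m < i" "Suc i = 2 * m + 2"
        using top nat_neq_iff[of i m] by blast
      then show ?thesis
      proof cases
        case 1
        then show ?thesis using f(1) f(4)[of "Suc i"] m by (simp add: king_dist_def)
      next
        case 2
        then show ?thesis using f(1) f(3)[of "Suc i"] by (simp add: king_dist_def of_nat_diff)
      next
        case 3
        then show ?thesis using f(3)[of i] f(3)[of "Suc i"] by (simp add: king_dist_def of_nat_diff)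
      next
        case 4
        then show ?thesis using f(3)[of i] f(4)[of "Suc i"] by (simp add: king_dist_def of_nat_diff)
      next
        case 5
        then show ?thesis using f(4)[of i] f(4)[of "Suc i"] by (simp add: king_dist_def of_nat_diff)
      next
        case 6
        then show ?thesis using f(2) f(4)[of i] by (simp add: king_dist_def of_nat_diff)
      qed
    qed
    ultimately have "path_edges (c1 # M @ [c1]) \<subseteq> strip_edges (m + 1) A B []"
      by (rule path_along_cells)
    with sub have "path_edges (c1 # L1) \<union> path_edges (c1 # L2) \<subseteq> strip_edges (m + 1) A B []"
      by (rule subset_trans)
    moreover have "mset A + mset B + mset [] = mset (c1 # L1 @ L2)"
    proof -
      have "mset (drop m M) + mset (take m M) = mset M"
        by (metis add.commute append_take_drop_id mset_append)
      then show ?thesis by (simp add: A_def B_def) (simp add: M_def)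
    qed
    moreover have "snake_top (int (m + 1 + length [])) (int (length A)) (int (length B)) (int m + 1, int m)"
      by (simp add: snake_top_def lens)
    ultimately show ?thesis
      using lens c1 False len
      by (intro exI[of _ "m + 1"] exI[of _ A] exI[of _ B] exI[of _ "[]"] exI[of _ "(int m + 1, int m)"] conjI)
        simp_all
  qed
qed

text \<open>An empty \<open>s2\<close> makes three legs start at the second branch vertex.
  Hypothesis \<open>s\<close> then identifies it with \<open>c1\<close> and puts it in the middle
  row, where each leg has a free cell within reach.\<close>

theorem lay_caterpillar:
  assumes dist: "distinct (c1 # L1 @ L2 @ s1 @ L3 @ s2 @ L4 @ L5)"
    and "L1 \<noteq> []" "L2 \<noteq> []" and s: "s2 \<noteq> [] \<or> s1 = [] \<and> even (length L1 + length L2)"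
    and E: "E \<subseteq> path_edges (c1 # L1) \<union> path_edges (c1 # L2)
      \<union> path_edges (c1 # s1) \<union> path_edges (last (c1 # s1) # L3) \<union> path_edges (last (c1 # s1) # s2)
      \<union> path_edges (last (last (c1 # s1) # s2) # L4) \<union> path_edges (last (last (c1 # s1) # s2) # L5)"
  shows "\<exists>lo A B C. distinct (A @ B @ C) \<and> set (A @ B @ C) = set (c1 # L1 @ L2 @ s1 @ L3 @ s2 @ L4 @ L5)
    \<and> 1 \<le> lo \<and> lo \<le> length A \<and> lo \<le> length B \<and> E \<subseteq> strip_edges lo A B C"
proof -
  obtain lo A B C p where bot: "mset A + mset B + mset C = mset (c1 # L1 @ L2)"
    "1 \<le> lo" "lo \<le> length A" "lo \<le> length B"
    "path_edges (c1 # L1) \<union> path_edges (c1 # L2) \<subseteq> strip_edges lo A B C"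
    "cell lo A B C c1 p" "snake_top (int (lo + length C)) (int (length A)) (int (length B)) p"
    "even (length L1 + length L2) \<longrightarrow> p = (int (lo + length C) - 1, int (lo + length C) - 1)"
    using lay_bottom[OF assms(2,3), of c1] by blast
  obtain A' B' C' where up: "mset A' + mset B' + mset C' = mset (s1 @ L3 @ s2 @ L4 @ L5)"
    "path_edges (c1 # s1) \<union> path_edges (last (c1 # s1) # L3) \<union> path_edges (last (c1 # s1) # s2)
      \<union> path_edges (last (last (c1 # s1) # s2) # L4) \<union> path_edges (last (last (c1 # s1) # s2) # L5)
      \<subseteq> strip_edges lo (A @ A') (B @ B') (C @ C')"
    using lay_upper[OF bot(6,7), of s2 s1 L3 L4 L5] s bot(8) by blast
  let ?L = "(A @ A') @ (B @ B') @ (C @ C')"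
  have "mset ?L = (mset A + mset B + mset C) + (mset A' + mset B' + mset C')"
    by (simp add: ac_simps)
  also have "\<dots> = mset (c1 # L1 @ L2 @ s1 @ L3 @ s2 @ L4 @ L5)"
    unfolding bot(1) up(1) by simp
  finally have eq: "mset ?L = mset (c1 # L1 @ L2 @ s1 @ L3 @ s2 @ L4 @ L5)" .
  have "E \<subseteq> strip_edges lo (A @ A') (B @ B') (C @ C')"
    using E bot(5) up(2) strip_edges_append[of lo A B C A' B' C'] by blast
  moreover have "distinct ?L" using dist mset_eq_imp_distinct_iff[OF eq] by blast
  moreover have "set ?L = set (c1 # L1 @ L2 @ s1 @ L3 @ s2 @ L4 @ L5)"
    by (rule mset_eq_setD[OF eq])
  ultimately show ?thesis
    using bot(2-4) by (intro exI[of _ lo] exI[of _ "A @ A'"] exI[of _ "B @ B'"] exI[of _ "C @ C'"]) simp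
qed

section \<open>Attaching legs\<close>

definition strip_layout :: "'a set \<Rightarrow> 'a rel \<Rightarrow> bool" where
  "strip_layout X D \<longleftrightarrow> (\<exists>lo A B C. distinct (A @ B @ C) \<and> set (A @ B @ C) = X
    \<and> 1 \<le> lo \<and> lo \<le> length A \<and> lo \<le> length B \<and> D \<subseteq> strip_edges lo A B C)"

lemma mset_eq_mset_setD:
  assumes "mset xs = mset_set X" "finite X"
  shows "distinct xs" "set xs = X"
proof -
  show *: "set xs = X" using assms by (metis finite_set_mset_mset_set set_mset_mset)
  show "distinct xs"
    unfolding distinct_count_atmost_1 using assms by (simp add: * count_mset_set')
qed

lemma mset_mset_setI: "distinct xs \<Longrightarrow> set xs = X \<Longrightarrow> mset xs = mset_set X"
  by (metis mset_set_set)

lemma strip_layoutI: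
  assumes "mset (c1 # L1 @ L2 @ s1 @ L3 @ s2 @ L4 @ L5) = mset_set X" "finite X"
    and "L1 \<noteq> []" "L2 \<noteq> []" "s2 \<noteq> [] \<or> s1 = [] \<and> even (length L1 + length L2)"
    and "D \<subseteq> path_edges (c1 # L1) \<union> path_edges (c1 # L2)
      \<union> path_edges (c1 # s1) \<union> path_edges (last (c1 # s1) # L3) \<union> path_edges (last (c1 # s1) # s2)
      \<union> path_edges (last (last (c1 # s1) # s2) # L4) \<union> path_edges (last (last (c1 # s1) # s2) # L5)"
  shows "strip_layout X D"
  using lay_caterpillar[OF mset_eq_mset_setD(1)[OF assms(1,2)] assms(3-6)]
  unfolding strip_layout_def mset_eq_mset_setD(2)[OF assms(1,2)] .

text \<open>Of three legs at the same vertex, two have lengths of the same parity.\<close>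

lemma strip_layout_three_legs:
  assumes X: "mset (c # p @ q @ u @ s @ a @ b) = mset_set X" "finite X"
    and ne: "p \<noteq> []" "q \<noteq> []" "u \<noteq> []"
    and D: "D \<subseteq> path_edges (c # p) \<union> path_edges (c # q) \<union> path_edges (c # u)
      \<union> path_edges (c # s) \<union> path_edges (last (c # s) # a) \<union> path_edges (last (c # s) # b)"
  shows "strip_layout X D"
proof -
  consider "even (length p + length q)" | "even (length p + length u)" | "even (length q + length u)"
    by (metis even_add)
  then show ?thesis
  proof cases
    case 1
    \<comment> \<open>An empty first spine and an even sum satisfy the condition of
      \<open>strip_layoutI\<close> even when \<open>s\<close> is empty.\<close>
    show ?thesis
      by (rule strip_layoutI[of c p q "[]" u s a b, OF _ X(2) ne(1,2)]) (use X(1) 1 D in \<open>simp_all add: ac_simps\<close>)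
  next
    case 2
    show ?thesis
      by (rule strip_layoutI[of c p u "[]" q s a b, OF _ X(2) ne(1,3)]) (use X(1) 2 D in \<open>simp_all add: ac_simps\<close>)
  next
    case 3
    show ?thesis
      by (rule strip_layoutI[of c q u "[]" p s a b, OF _ X(2) ne(2,3)]) (use X(1) 3 D in \<open>simp_all add: ac_simps\<close>)
  qed
qed

text \<open>A subdivided claw with centre \<open>c\<close>. The multiset equation expresses
  distinctness and the vertex set at once and turns permuting legs into commutativity.
  \<open>L\<close> will be the set of leaves.\<close>

definition tripod :: "'a set \<Rightarrow> 'a set \<Rightarrow> 'a rel \<Rightarrow> 'a \<Rightarrow> 'a list \<Rightarrow> 'a list \<Rightarrow> 'a list \<Rightarrow> bool" where
  "tripod L X D c p q s \<longleftrightarrow> finite X \<and> mset (c # p @ q @ s) = mset_set X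
    \<and> p \<noteq> [] \<and> q \<noteq> [] \<and> s \<noteq> [] \<and> {last p, last q, last s} \<subseteq> L
    \<and> D \<subseteq> path_edges (c # p) \<union> path_edges (c # q) \<union> path_edges (c # s)"

text \<open>The shape of a tree with four leaves: legs \<open>p\<close>, \<open>q\<close> at
  \<open>c\<close> and legs \<open>a\<close>, \<open>b\<close> at the far end of the spine. For
  \<open>s = []\<close> it is a star with four legs.\<close>

definition double_fork ::
    "'a set \<Rightarrow> 'a set \<Rightarrow> 'a rel \<Rightarrow> 'a \<Rightarrow> 'a list \<Rightarrow> 'a list \<Rightarrow> 'a list \<Rightarrow> 'a list \<Rightarrow> 'a list \<Rightarrow> bool" where
  "double_fork L X D c p q s a b \<longleftrightarrow> finite X \<and> mset (c # p @ q @ s @ a @ b) = mset_set X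
    \<and> p \<noteq> [] \<and> q \<noteq> [] \<and> a \<noteq> [] \<and> b \<noteq> [] \<and> {last p, last q, last a, last b} \<subseteq> L
    \<and> D \<subseteq> path_edges (c # p) \<union> path_edges (c # q) \<union> path_edges (c # s)
      \<union> path_edges (last (c # s) # a) \<union> path_edges (last (c # s) # b)"

lemma tripod_swap: "tripod L X D c p q s \<Longrightarrow> tripod L X D c q p s"
  and tripod_rotate: "tripod L X D c p q s \<Longrightarrow> tripod L X D c s p q"
  by (auto simp: tripod_def ac_simps)

lemma double_fork_swap: "double_fork L X D c p q s a b \<Longrightarrow> double_fork L X D c q p s a b"
  by (auto simp: double_fork_def ac_simps)

lemma double_fork_rev:
  assumes "double_fork L X D c p q s a b"
  shows "double_fork L X D (last (c # s)) a b (tl (rev (c # s))) p q"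
proof -
  have rev: "last (c # s) # tl (rev (c # s)) = rev (c # s)"
    by (metis hd_rev list.collapse list.distinct(1) rev_is_Nil_conv)
  have "mset (last (c # s) # a @ b @ tl (rev (c # s)) @ p @ q)
      = mset (last (c # s) # tl (rev (c # s))) + mset a + mset b + mset p + mset q"
    by (simp add: ac_simps)
  also have "\<dots> = mset (c # p @ q @ s @ a @ b)"
    unfolding rev by (simp add: ac_simps)
  finally have mset: "mset (last (c # s) # a @ b @ tl (rev (c # s)) @ p @ q) = mset_set X"
    using assms by (simp only: double_fork_def)
  have last: "last (last (c # s) # tl (rev (c # s))) = c"
    unfolding rev by (simp only: last_rev list.distinct not_False_eq_True list.sel)
  show ?thesis
    using assms mset unfolding double_fork_def last unfolding rev path_edges_rev by blast
qed

context
  fixes X L :: "'a set" and D :: "'a rel" and x :: 'a and u :: "'a list"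
  assumes x: "x \<notin> L" and u: "u \<noteq> []" "distinct u" "set u \<inter> X = {}" "last u \<in> L"
begin

lemma mset_set_attach: "finite X \<Longrightarrow> mset_set (X \<union> set u) = mset_set X + mset u"
  using u by (simp add: mset_set_Union mset_set_set Int_commute)

text \<open>A leg ends in \<open>L\<close> while \<open>x\<close> is outside \<open>L\<close>, so
  something is left behind \<open>x\<close>.\<close>

lemma split_leg:
  assumes "x \<in> set p" "last p \<in> L"
  shows "\<exists>p1 p2. p = p1 @ x # p2 \<and> p2 \<noteq> []"
proof -
  obtain p1 p2 where "p = p1 @ x # p2" using assms(1) by (auto simp: in_set_conv_decomp)
  moreover from this have "p2 \<noteq> []" using assms(2) x by auto
  ultimately show ?thesis by blast
qed

text \<open>\<open>x\<close> is not an end of the path, so it cuts it into two non-empty legs, and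
  \<open>u\<close> is the third.\<close>

lemma attach_to_path:
  assumes "finite X" "mset P = mset_set X" "x \<in> X" "hd P \<in> L" "last P \<in> L" "D \<subseteq> path_edges P"
  shows "\<exists>c p q s. tripod L (X \<union> set u) (D \<union> path_edges (x # u)) c p q s"
proof -
  have "x \<in> set P" using assms(2,3) mset_eq_mset_setD[OF assms(2,1)] by simp
  then obtain p q where P: "P = p @ x # q" "q \<noteq> []" using split_leg assms(5) by blast
  then have p: "p \<noteq> []" using assms(4) x by auto
  have "path_edges P = path_edges (rev (p @ [x])) \<union> path_edges (x # q)"
    unfolding P(1) path_edges_rev by (rule path_edges_append)
  then have "tripod L (X \<union> set u) (D \<union> path_edges (x # u)) x (rev p) q u"
    using assms p P u mset_set_attach by (auto simp: tripod_def last_rev ac_simps assms(2)[symmetric])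
  then show ?thesis by blast
qed

text \<open>Attaching at the centre gives a star with four legs. Attaching inside a leg turns the
  part of that leg up to \<open>x\<close> into the spine.\<close>

lemma attach_to_tripod:
  assumes tri: "tripod L X D c p q s" and "x \<in> X"
  shows "\<exists>c p q s a b. double_fork L (X \<union> set u) (D \<union> path_edges (x # u)) c p q s a b"
proof -
  have leg: ?thesis if xp: "x \<in> set p" and tri: "tripod L X D c p q s" for p q s
  proof -
    obtain p1 p2 where p: "p = p1 @ x # p2" "p2 \<noteq> []"
      using split_leg[OF xp] tri unfolding tripod_def by blast
    have "path_edges (c # p) = path_edges (c # p1 @ [x]) \<union> path_edges (x # p2)"
      using path_edges_append[of "c # p1" x p2] by (simp add: p)
    moreover have "mset (c # q @ s @ (p1 @ [x]) @ p2 @ u) = mset_set X + mset u"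
      using tri by (simp add: tripod_def p ac_simps add_mset_commute)
    ultimately have "double_fork L (X \<union> set u) (D \<union> path_edges (x # u)) c q s (p1 @ [x]) p2 u"
      using tri p u mset_set_attach unfolding double_fork_def tripod_def by auto
    then show ?thesis by blast
  qed
  have "set (c # p @ q @ s) = X"
    using tri mset_eq_mset_setD(2) unfolding tripod_def by blast
  then consider "x = c" | "x \<in> set p" | "x \<in> set q" | "x \<in> set s" using \<open>x \<in> X\<close> by auto
  then show ?thesis
  proof cases
    case 1
    have "mset (c # p @ q @ [] @ s @ u) = mset_set X + mset u"
      using tri by (simp add: tripod_def ac_simps)
    then have "double_fork L (X \<union> set u) (D \<union> path_edges (x # u)) c p q [] s u"
      using tri u mset_set_attach 1 unfolding double_fork_def tripod_def by auto
    then show ?thesis by blast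
  next
    case 2
    then show ?thesis using leg tri by blast
  next
    case 3
    then show ?thesis using leg tripod_swap[OF tri] by blast
  next
    case 4
    then show ?thesis using leg tripod_rotate[OF tri] by blast
  qed
qed

text \<open>By \<open>double_fork_swap\<close> and \<open>double_fork_rev\<close> it suffices to
  attach at \<open>c\<close>, inside the spine or inside the leg \<open>p\<close>.\<close>

lemma attach_to_double_fork:
  assumes df: "double_fork L X D c p q s a b" and "x \<in> X"
  shows "strip_layout (X \<union> set u) (D \<union> path_edges (x # u))"
proof -
  have fin: "finite (X \<union> set u)" using df by (simp add: double_fork_def)
  have mset: "mset_set (X \<union> set u) = mset (c # p @ q @ s @ a @ b) + mset u"
    if "double_fork L X D c p q s a b" for c p q s a b
    using that mset_set_attach by (simp add: double_fork_def)
  have base: ?thesis if df: "double_fork L X D c p q s a b" and "x = c" for c p q s a b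
    by (rule strip_layout_three_legs[of c p q u s a b])
      (use df u mset[OF df] that(2) fin in \<open>auto simp: double_fork_def ac_simps add_mset_commute\<close>)
  have leg: ?thesis if df: "double_fork L X D c p q s a b" and xp: "x \<in> set p" for c p q s a b
  proof -
    obtain p1 p2 where p: "p = p1 @ x # p2" "p2 \<noteq> []"
      using split_leg[OF xp] df unfolding double_fork_def by blast
    have eq: "path_edges (c # p) = path_edges (c # p1 @ [x]) \<union> path_edges (x # p2)"
      using path_edges_append[of "c # p1" x p2] by (simp add: p)
    show ?thesis
    proof (cases "s = []")
      case True
      \<comment> \<open>All four legs meet at \<open>c\<close>. Cutting \<open>p\<close> at
        \<open>x\<close> leaves three legs there, and \<open>p1 @ [x]\<close> is the spine to the
        fork into \<open>p2\<close> and \<open>u\<close>.\<close>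
      show ?thesis
        by (rule strip_layout_three_legs[of c q a b "p1 @ [x]" p2 u])
          (use df u mset[OF df] p eq fin True in \<open>auto simp: double_fork_def ac_simps add_mset_commute\<close>)
    next
      case False
      \<comment> \<open>The layout starts at \<open>x\<close> with the legs \<open>p2\<close> and
        \<open>u\<close>. Its first spine is the reversed piece of \<open>p\<close> ending in
        \<open>c\<close>, where \<open>q\<close> becomes the middle leg.\<close>
      have "path_edges (c # p1 @ [x]) = path_edges (x # rev p1 @ [c])"
        using path_edges_rev[of "c # p1 @ [x]"] by simp
      then show ?thesis
        by (intro strip_layoutI[of x p2 u "rev p1 @ [c]" q s a b])
          (use df u mset[OF df] p eq fin False in \<open>auto simp: double_fork_def ac_simps add_mset_commute\<close>)
    qed
  qed
  have "set (c # p @ q @ s @ a @ b) = X"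
    using df mset_eq_mset_setD(2) unfolding double_fork_def by blast
  then consider "x = c" | "x = last (c # s)" | "x \<in> set (butlast s)"
    | "x \<in> set p" | "x \<in> set q" | "x \<in> set a" | "x \<in> set b"
    using \<open>x \<in> X\<close> by (cases s rule: rev_cases) auto
  then show ?thesis
  proof cases
    case 1
    then show ?thesis using base df by blast
  next
    case 2
    then show ?thesis using base[OF double_fork_rev[OF df]] by blast
  next
    case 3
    then obtain s1 s2 where "butlast s = s1 @ x # s2" by (auto simp: in_set_conv_decomp)
    \<comment> \<open>\<open>x\<close> is not the last vertex of the spine, so \<open>s3\<close> is
      non-empty and \<open>u\<close> can serve as the middle leg.\<close>
    then obtain s3 where s: "s = (s1 @ [x]) @ s3" "s3 \<noteq> []"
      using 3 by (cases s rule: rev_cases) auto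
    have "path_edges (c # s) = path_edges (c # s1 @ [x]) \<union> path_edges (x # s3)"
      using path_edges_append[of "c # s1" x s3] by (simp add: s)
    then show ?thesis
      by (intro strip_layoutI[of c p q "s1 @ [x]" u s3 a b])
        (use df u mset[OF df] s fin in \<open>auto simp: double_fork_def ac_simps add_mset_commute\<close>)
  next
    case 4
    then show ?thesis using leg df by blast
  next
    case 5
    then show ?thesis using leg double_fork_swap[OF df] by blast
  next
    case 6
    then show ?thesis using leg double_fork_rev[OF df] by blast
  next
    case 7
    then show ?thesis using leg double_fork_swap[OF double_fork_rev[OF df]] by blast
  qed
qed

end

section \<open>Strong dimension of trees\<close>

locale tree_graph =
  fixes T :: "'a pair_pre_digraph"
  assumes tree: "undirected_tree T"
begin

lemma pair_graph: "pair_graph T" and conn: "connected T"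
  using tree by (simp_all add: undirected_tree_def)

lemmas sym = pair_graph_sym[OF pair_graph] and wf = pair_graph_wf[OF pair_graph]

abbreviation path :: "'a \<Rightarrow> 'a list \<Rightarrow> 'a \<Rightarrow> bool" where
  "path \<equiv> path_between T"

lemma path_iff:
  "path u p v \<longleftrightarrow> p \<noteq> [] \<and> distinct p \<and> set p \<subseteq> pverts T \<and> set (vwalk_arcs p) \<subseteq> parcs T
    \<and> hd p = u \<and> last p = v"
  by (auto simp: path_between_def vpath_with_proj)

lemma path_ex: "u \<in> pverts T \<Longrightarrow> v \<in> pverts T \<Longrightarrow> \<exists>p. path u p v"
  by (rule connected_imp_path_between[OF pair_graph conn])

lemma path_rev: "path u p v \<Longrightarrow> path v (rev p) u"
  using sym by (auto simp: path_iff set_vwalk_arcs_rev hd_rev last_rev)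

lemma path_single: "u \<in> pverts T \<Longrightarrow> path u [u] u"
  by (simp add: path_iff)

lemma path_Cons: "(u, v) \<in> parcs T \<Longrightarrow> path v p w \<Longrightarrow> u \<notin> set p \<Longrightarrow> path u (u # p) w"
  using wf by (auto simp: path_iff)

lemma path_prefix: "path u (p @ x # q) v \<Longrightarrow> path u (p @ [x]) x"
  using path_between_suffix[of T v "rev q" x "rev p" u] path_rev[of u "p @ x # q" v]
    path_rev[of x "x # rev p" u] by simp

text \<open>A walk avoiding \<open>u\<close> shortens to a path avoiding \<open>u\<close>, and
  prefixing \<open>u\<close> closes it to a cycle.\<close>

lemma walk_between_neighbours:
  assumes "(u, x) \<in> parcs T" "(u, y) \<in> parcs T" "x \<noteq> y"
    and "vwalk p (with_proj T)" "hd p = x" "last p = y"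
  shows "u \<in> set p"
proof (rule ccontr)
  assume "u \<notin> set p"
  obtain q where q: "path x q y" "set q \<subseteq> set p"
    using vwalk_imp_path_between[OF assms(4-6)] by blast
  have "path u (u # q) y" using assms(1) q \<open>u \<notin> set p\<close> by (intro path_Cons) auto
  moreover have "2 \<le> length q"
  proof -
    obtain a q' where "q = a # q'" using q(1) by (cases q) (auto simp: path_iff)
    with q(1) assms(3) show ?thesis by (cases q') (auto simp: path_iff)
  qed
  ultimately have "undirected_cycle T (u # q)"
    using sym[OF assms(2)] by (auto simp: undirected_cycle_def path_between_def)
  then show False using tree by (auto simp: undirected_tree_def)
qed

text \<open>If the paths left \<open>u\<close> through different neighbours, one tail followed by
  the reverse of the other would join these neighbours while avoiding \<open>u\<close>.\<close>

lemma path_unique: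
  assumes "path u p v" "path u q v"
  shows "p = q"
  using assms
proof (induction p arbitrary: u q rule: list.induct)
  case (Cons a p)
  obtain q' where q: "q = a # q'" using Cons.prems by (cases q) (auto simp: path_iff)
  consider "p = []" | "q' = []" | "p \<noteq> []" "q' \<noteq> []" by blast
  then show ?case
  proof cases
    case 1
    then have "v = a" using Cons.prems(1) by (auto simp: path_iff)
    then have "q' = []" using Cons.prems(2) last_in_set[of q'] by (auto simp: path_iff q split: if_splits)
    then show ?thesis using 1 q by simp
  next
    case 2
    then have "v = a" using Cons.prems(2) by (auto simp: path_iff q)
    then have "p = []" using Cons.prems(1) last_in_set[of p] by (auto simp: path_iff split: if_splits)
    then show ?thesis using 2 q by simp
  next
    case 3
    then have p': "path (hd p) p v" "(a, hd p) \<in> parcs T" "a \<notin> set p"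
      and q': "path (hd q') q' v" "(a, hd q') \<in> parcs T" "a \<notin> set q'"
      using Cons.prems by (auto simp: path_iff q)
    have "hd p = hd q'"
    proof (rule ccontr)
      assume "hd p \<noteq> hd q'"
      have walks: "vwalk p (with_proj T)" "vwalk (rev q') (with_proj T)" "last p = hd (rev q')"
        using p'(1) path_rev[OF q'(1)] by (auto simp: path_between_def vpath_def)
      have "last (rev q') = hd q'" using 3 by (simp add: last_rev)
      then have "a \<in> set (p @ tl (rev q'))"
        using vwalk_glue[OF walks] by (intro walk_between_neighbours[OF p'(2) q'(2) \<open>hd p \<noteq> hd q'\<close>]) simp_all
      then show False using p'(3) q'(3) list.set_sel(2)[of "rev q'"] 3 by auto
    qed
    then show ?thesis using Cons.IH[of "hd p" q'] p' q' q by simp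
  qed
qed (simp add: path_iff)

lemma path_shortest: "path u p v \<Longrightarrow> shortest_path T u p v"
  unfolding shortest_path_def using path_unique by (metis order_refl)

lemma neighbour_on_path:
  assumes "path u p v" "(u, x) \<in> parcs T" "x \<in> set p"
  shows "\<exists>p'. p = u # x # p'"
proof -
  obtain q r where p: "p = q @ x # r" using assms(3) by (auto simp: in_set_conv_decomp)
  have "path u (q @ [x]) x" using path_prefix assms(1) p by simp
  moreover have "path u [u, x] x"
    using path_Cons[OF assms(2) path_single] wf[OF assms(2)] by simp
  ultimately have "q @ [x] = [u, x]" by (rule path_unique)
  then show ?thesis using p by simp
qed

text \<open>An isolated vertex counts as a leaf, so that \<open>card_leaves\<close> also covers the
  tree with one vertex.\<close>

definition leaves :: "'a set" where
  "leaves = {x \<in> pverts T. \<forall>y z. (x, y) \<in> parcs T \<longrightarrow> (x, z) \<in> parcs T \<longrightarrow> y = z}"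

text \<open>An inner vertex of a path has two distinct neighbours on it.\<close>

lemma leaf_on_path:
  assumes "path u p v" "x \<in> leaves" "x \<in> set p"
  shows "x = u \<or> x = v"
proof (rule ccontr)
  assume ne: "\<not> (x = u \<or> x = v)"
  obtain q r where p: "p = q @ x # r" using assms(3) by (auto simp: in_set_conv_decomp)
  have "q \<noteq> []" "r \<noteq> []" using ne assms(1) p by (auto simp: path_iff)
  then have "(last q, x) \<in> parcs T" "(x, hd r) \<in> parcs T" "set q \<inter> set r = {}"
    using assms(1) p by (auto simp: path_iff vwalk_arcs_append)
  moreover from this have "last q \<noteq> hd r"
    using \<open>q \<noteq> []\<close> \<open>r \<noteq> []\<close> last_in_set[of q] hd_in_set[of r] by (metis disjoint_iff)
  ultimately show False using assms(2) sym by (auto simp: leaves_def)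
qed

text \<open>A longest path from \<open>u\<close> through \<open>v\<close> ends in a leaf, since it
  could be prolonged otherwise.\<close>

lemma extend_to_leaf:
  assumes "u \<in> pverts T" "v \<in> pverts T" "u \<noteq> v"
  shows "\<exists>w p. w \<in> leaves \<and> w \<noteq> u \<and> path u p w \<and> v \<in> set p"
proof -
  define P where "P p \<longleftrightarrow> (\<exists>w. path u p w) \<and> v \<in> set p" for p
  obtain p0 where p0: "path u p0 v" using path_ex assms by blast
  then have "P p0" using last_in_set[of p0] by (auto simp: P_def path_iff)
  moreover have "length p < Suc (card (pverts T))" if "P p" for p
  proof -
    have "length p = card (set p)" "set p \<subseteq> pverts T"
      using that by (auto simp: P_def path_iff distinct_card)
    then show ?thesis using card_mono[OF pair_graph_finite[OF pair_graph]] by (simp add: less_Suc_eq_le)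
  qed
  ultimately obtain p where p: "P p" "\<And>q. P q \<Longrightarrow> length q \<le> length p"
    using ex_has_greatest_nat[of P p0 length "Suc (card (pverts T))"] by blast
  then obtain w where w: "path u p w" "v \<in> set p" by (auto simp: P_def)
  have "w \<in> leaves"
  proof (rule ccontr)
    assume "w \<notin> leaves"
    moreover have "w \<in> pverts T" using w(1) last_in_set[of p] by (auto simp: path_iff)
    ultimately obtain y z where yz: "(w, y) \<in> parcs T" "(w, z) \<in> parcs T" "y \<noteq> z"
      by (auto simp: leaves_def)
    \<comment> \<open>A neighbour of \<open>w\<close> on \<open>p\<close> has to be the second
      vertex of \<open>rev p\<close>, so \<open>y\<close> and \<open>z\<close> cannot both lie on
      \<open>p\<close>.\<close>
    obtain x where x: "(w, x) \<in> parcs T" "x \<notin> set p"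
    proof (cases "y \<in> set p \<and> z \<in> set p")
      case True
      then obtain p1 p2 where "rev p = w # y # p1" "rev p = w # z # p2"
        using neighbour_on_path[OF path_rev[OF w(1)]] yz by (metis set_rev)
      then show ?thesis using yz(3) by simp
    next
      case False
      then show ?thesis using that yz by blast
    qed
    have "path x (x # rev p) u"
      using path_Cons[OF sym[OF x(1)] path_rev[OF w(1)]] x(2) by simp
    then have "P (p @ [x])" using path_rev w(2) unfolding P_def by fastforce
    then show False using p(2) by fastforce
  qed
  moreover have "w \<noteq> u"
  proof
    assume "w = u"
    then have "p = [u]" using path_unique w(1) path_single assms(1) by blast
    then show False using w(2) assms(3) by simp
  qed
  ultimately show ?thesis using w by blast
qed

lemma strongly_resolves_path: "path u p w \<Longrightarrow> v \<in> set p \<Longrightarrow> strongly_resolves T w u v"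
  unfolding strongly_resolves_def using path_shortest by blast

text \<open>Prolonging the path from \<open>u\<close> through \<open>v\<close>, and the one from
  \<open>v\<close> through \<open>u\<close>, leads to two different leaves: from a common one, the
  path from \<open>v\<close> would be a proper suffix of that from \<open>u\<close> and miss
  \<open>u\<close>. So one of the two leaves is not \<open>r\<close>, and either of them resolves
  the pair.\<close>

lemma leaves_minus_one_resolving:
  assumes "r \<in> leaves"
  shows "strong_resolving_set T (leaves - {r})"
  unfolding strong_resolving_set_def
proof (intro conjI ballI impI)
  show "leaves - {r} \<subseteq> pverts T" by (auto simp: leaves_def)
next
  fix u v assume uv: "u \<in> pverts T" "v \<in> pverts T" "u \<noteq> v"
  obtain w p where w: "w \<in> leaves" "path u p w" "v \<in> set p"
    using extend_to_leaf[OF uv] by blast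
  obtain x q where x: "x \<in> leaves" "path v q x" "u \<in> set q"
    using extend_to_leaf[OF uv(2,1)] uv(3) by blast
  have "w \<noteq> r \<or> x \<noteq> r"
  proof (rule ccontr)
    assume *: "\<not> (w \<noteq> r \<or> x \<noteq> r)"
    obtain p1 p2 where p: "p = p1 @ v # p2" using w(3) by (auto simp: in_set_conv_decomp)
    have "q = v # p2"
      using path_between_suffix w(2) x(2) * unfolding p by (intro path_unique[OF x(2)]) auto
    then have "u \<in> set (v # p2)" using x(3) by simp
    moreover have "p1 \<noteq> []" "hd p = u" using w(2) uv(3) p by (auto simp: path_iff)
    ultimately show False using w(2) p by (cases p1) (auto simp: path_iff)
  qed
  then show "\<exists>y \<in> leaves - {r}. strongly_resolves T y u v"
  proof
    assume "w \<noteq> r"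
    then show ?thesis using strongly_resolves_path[OF w(2,3)] w(1) by blast
  next
    assume "x \<noteq> r"
    then show ?thesis
      using strongly_resolves_path[OF x(2,3)] x(1) strongly_resolves_commute[of T x u v] by blast
  qed
qed

text \<open>If \<open>W\<close> missed two leaves, one of them would lie on a path from the other to
  some \<open>w\<close> in \<open>W\<close> without being an end of that path.\<close>

lemma resolving_set_misses_at_most_one_leaf:
  assumes W: "strong_resolving_set T W"
  shows "card leaves \<le> Suc (card W)"
proof -
  have fin: "finite (pverts T)" by (rule pair_graph_finite[OF pair_graph])
  then have "finite W" using W by (auto simp: strong_resolving_set_def finite_subset)
  have eq: "x = y" if xy: "x \<in> leaves - W" "y \<in> leaves - W" for x y
  proof (rule ccontr)
    assume "x \<noteq> y"
    then obtain w where "w \<in> W" "strongly_resolves T w x y"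
      using W xy unfolding strong_resolving_set_def leaves_def by blast
    then show False
      unfolding strongly_resolves_def shortest_path_def using leaf_on_path xy \<open>x \<noteq> y\<close> by blast
  qed
  obtain a where "leaves - W \<subseteq> {a}"
  proof (cases "leaves - W = {}")
    case False
    then obtain b where "b \<in> leaves - W" by blast
    then show ?thesis using eq that[of b] by blast
  qed auto
  then have "leaves \<subseteq> insert a W" by blast
  then have "card leaves \<le> card (insert a W)" using \<open>finite W\<close> by (intro card_mono) auto
  also have "\<dots> \<le> Suc (card W)" by (rule card_insert_le_m1[THEN le_trans]) (auto simp: card_insert_if \<open>finite W\<close>)
  finally show ?thesis .
qed

lemma finite_leaves: "finite leaves"
  using pair_graph_finite[OF pair_graph] by (simp add: leaves_def)

lemma leaves_nonempty: "leaves \<noteq> {}"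
proof -
  obtain u where u: "u \<in> pverts T" using conn connected_iff_rtrancl[OF pair_graph] by blast
  show ?thesis
  proof (cases "\<exists>v. (u, v) \<in> parcs T")
    case True
    then show ?thesis using extend_to_leaf[OF u] wf by blast
  qed (use u in \<open>auto simp: leaves_def\<close>)
qed

theorem card_leaves: "card leaves = Suc (strong_dimension T)"
proof (rule antisym)
  obtain W where "strong_resolving_set T W" "card W = strong_dimension T"
    using strong_dimension_attained[OF pair_graph conn] by blast
  then show "card leaves \<le> Suc (strong_dimension T)"
    using resolving_set_misses_at_most_one_leaf by metis
  obtain r where r: "r \<in> leaves" using leaves_nonempty by blast
  have "strong_dimension T \<le> card (leaves - {r})"
    by (rule strong_dimension_le[OF leaves_minus_one_resolving[OF r]])
  then show "Suc (strong_dimension T) \<le> card leaves"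
    using card_Suc_Diff1[OF finite_leaves r] by simp
qed

end

section \<open>Trees with five leaves\<close>

locale rooted_tree_graph = tree_graph +
  fixes r :: 'a
  assumes root: "r \<in> pverts T"
begin

definition to_root :: "'a \<Rightarrow> 'a list" where
  "to_root v = (THE p. path v p r)"

text \<open>For \<open>v = r\<close> the list has a single entry and the value is arbitrary, hence
  the conditions \<open>v \<noteq> r\<close> below.\<close>

definition parent :: "'a \<Rightarrow> 'a" where
  "parent v = to_root v ! 1"

lemma to_rootI: "path v p r \<Longrightarrow> to_root v = p"
  unfolding to_root_def using path_unique by (intro the_equality)

lemma to_root: "v \<in> pverts T \<Longrightarrow> path v (to_root v) r"
  using path_ex[of v r] root to_rootI by metis

lemma to_root_parent:
  assumes "v \<in> pverts T" "v \<noteq> r"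
  shows "to_root v = v # to_root (parent v)" "parent v \<in> pverts T" "(v, parent v) \<in> parcs T"
proof -
  have p: "path v (to_root v) r" using to_root assms(1) .
  then obtain x q where q: "to_root v = v # x # q"
    using assms(2) by (cases "to_root v"; cases "tl (to_root v)") (auto simp: path_iff)
  then have "to_root x = x # q" using p by (intro to_rootI) (auto simp: path_iff)
  moreover have "parent v = x" by (simp add: parent_def q)
  moreover have "x \<in> pverts T" "(v, x) \<in> parcs T" using p q by (auto simp: path_iff)
  ultimately show "to_root v = v # to_root (parent v)" "parent v \<in> pverts T" "(v, parent v) \<in> parcs T"
    using q by simp_all
qed

text \<open>If \<open>y\<close> lies on the path from \<open>x\<close> to the root, it is its second
  vertex; otherwise prefixing \<open>y\<close> to that path gives the path from
  \<open>y\<close>.\<close>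

lemma arc_cases:
  assumes "(x, y) \<in> parcs T"
  shows "x \<noteq> r \<and> y = parent x \<or> y \<noteq> r \<and> x = parent y"
proof (cases "y \<in> set (to_root x)")
  case True
  then obtain p where p: "to_root x = x # y # p"
    using neighbour_on_path[OF to_root assms] wf[OF assms] by blast
  then have "x \<noteq> r"
    using to_rootI[OF path_single[OF root]] by auto
  with p show ?thesis by (simp add: parent_def)
next
  case False
  have "path x (to_root x) r" using to_root wf[OF assms] by blast
  then have *: "to_root y = y # to_root x"
    using path_Cons[OF sym[OF assms]] False by (intro to_rootI) blast
  moreover have "hd (to_root x) = x" "to_root x \<noteq> []" "last (to_root x) = r"
    using \<open>path x (to_root x) r\<close> by (simp_all add: path_iff)
  moreover have "y \<noteq> r" using False calculation(2-4) last_in_set by metis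
  ultimately show ?thesis by (simp add: parent_def hd_conv_nth)
qed

definition parent_edges :: "'a set \<Rightarrow> 'a rel" where
  "parent_edges X = {(v, parent v) |v. v \<in> X \<and> v \<noteq> r} \<union> {(parent v, v) |v. v \<in> X \<and> v \<noteq> r}"

lemma parent_edges_pverts: "parcs T \<subseteq> parent_edges (pverts T)"
proof (clarify)
  fix x y assume "(x, y) \<in> parcs T"
  then show "(x, y) \<in> parent_edges (pverts T)"
    using arc_cases[of x y] wf[of x y] unfolding parent_edges_def by blast
qed

lemma parent_edges_Un: "parent_edges (X \<union> Y) = parent_edges X \<union> parent_edges Y"
  by (auto simp: parent_edges_def)

text \<open>The vertex sets of the subtrees that contain the root.\<close>

definition closed :: "'a set \<Rightarrow> bool" where
  "closed X \<longleftrightarrow> r \<in> X \<and> X \<subseteq> pverts T \<and> (\<forall>v \<in> X. v \<noteq> r \<longrightarrow> parent v \<in> X)"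

lemma closed_to_root:
  assumes "closed X" "v \<in> X"
  shows "set (to_root v) \<subseteq> X"
  using assms(2)
proof (induction "length (to_root v)" arbitrary: v rule: less_induct)
  case less
  show ?case
  proof (cases "v = r")
    case True
    then show ?thesis using to_rootI[OF path_single[OF root]] less.prems by simp
  next
    case False
    have v: "v \<in> pverts T" "parent v \<in> X" using assms(1) less.prems False by (auto simp: closed_def)
    then show ?thesis using less.hyps[of "parent v"] to_root_parent(1)[OF v(1) False] less.prems by simp
  qed
qed

text \<open>Going from \<open>v\<close> towards the root, \<open>x\<close> is the first vertex in
  \<open>X\<close>, and \<open>u\<close> lists the vertices before it in reverse order.\<close>

lemma grow:
  assumes X: "closed X" and v: "v \<in> pverts T"
  shows "\<exists>x u. x \<in> X \<and> distinct u \<and> set u \<inter> X = {} \<and> last (x # u) = v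
    \<and> closed (X \<union> set u) \<and> parent_edges (set u) \<subseteq> path_edges (x # u)
    \<and> (u \<noteq> [] \<longrightarrow> (x, hd u) \<in> parcs T) \<and> set u \<subseteq> set (to_root v)"
  using v
proof (induction "length (to_root v)" arbitrary: v rule: less_induct)
  case less
  show ?case
  proof (cases "v \<in> X")
    case True
    then show ?thesis using X by (intro exI[of _ v] exI[of _ "[]"]) (simp add: parent_edges_def)
  next
    case False
    then have "v \<noteq> r" using X by (auto simp: closed_def)
    note pv = to_root_parent[OF less.prems \<open>v \<noteq> r\<close>]
    obtain x u where xu: "x \<in> X" "distinct u" "set u \<inter> X = {}" "last (x # u) = parent v"
      "closed (X \<union> set u)" "parent_edges (set u) \<subseteq> path_edges (x # u)"
      "u \<noteq> [] \<longrightarrow> (x, hd u) \<in> parcs T" "set u \<subseteq> set (to_root (parent v))"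
      using less.hyps[of "parent v"] pv by auto
    have nu: "v \<notin> set u"
      using to_root[OF less.prems] xu(8) pv(1) by (auto simp: path_iff)
    have "last (x # u @ [v]) = v" by simp
    moreover have "closed (X \<union> set (u @ [v]))"
    proof -
      have "parent v \<in> X \<union> set u" using xu(1,4) last_in_set[of "x # u"] by auto
      then show ?thesis using xu(5) less.prems by (auto simp: closed_def)
    qed
    moreover have "parent_edges (set (u @ [v])) \<subseteq> path_edges (x # u @ [v])"
    proof -
      obtain w where w: "x # u = w @ [parent v]"
        using xu(4) append_butlast_last_id[of "x # u"] by (metis list.distinct(1))
      then have "x # u @ [v] = w @ parent v # [v]"
        by (metis append.assoc append_Cons append_Nil)
      then have "path_edges (x # u @ [v]) = path_edges (x # u) \<union> path_edges [parent v, v]"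
        using path_edges_append[of w "parent v" "[v]"] w by metis
      moreover have "parent_edges {v} \<subseteq> path_edges [parent v, v]"
        by (auto simp: parent_edges_def)
      ultimately show ?thesis using xu(6) parent_edges_Un[of "set u" "{v}"] by auto
    qed
    moreover have "(x, hd (u @ [v])) \<in> parcs T"
      using xu(4,7) sym[OF pv(3)] by (cases u) auto
    ultimately show ?thesis
      using xu(1-3) xu(8) nu False pv(1) to_root[OF less.prems] by (intro exI[of _ x] exI[of _ "u @ [v]"]) auto
  qed
qed

end

context rooted_tree_graph
begin

text \<open>The second vertex \<open>k\<close> of \<open>X\<close> ensures that \<open>x\<close> has
  a neighbour inside \<open>X\<close>: its parent or, at the root, the next vertex towards
  \<open>k\<close>. As \<open>hd u\<close> is a neighbour outside \<open>X\<close>, \<open>x\<close>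
  is not a leaf, which the attachment lemmas require.\<close>

lemma grow_leaf:
  assumes X: "closed X" and r: "r \<in> leaves" and l: "l \<in> leaves" "l \<notin> X" and k: "k \<in> X" "k \<noteq> r"
  shows "\<exists>x u. x \<in> X \<and> x \<notin> leaves \<and> u \<noteq> [] \<and> distinct u \<and> set u \<inter> X = {} \<and> last u = l
    \<and> closed (X \<union> set u) \<and> parent_edges (X \<union> set u) \<subseteq> parent_edges X \<union> path_edges (x # u)
    \<and> set u \<inter> leaves \<subseteq> {l, r}"
proof -
  have lV: "l \<in> pverts T" using l(1) by (simp add: leaves_def)
  obtain x u where xu: "x \<in> X" "distinct u" "set u \<inter> X = {}" "last (x # u) = l"
    "closed (X \<union> set u)" "parent_edges (set u) \<subseteq> path_edges (x # u)"
    "u \<noteq> [] \<longrightarrow> (x, hd u) \<in> parcs T" "set u \<subseteq> set (to_root l)"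
    using grow[OF X lV] by blast
  have ne: "u \<noteq> []" using xu(1,4) l(2) by auto
  have hd: "(x, hd u) \<in> parcs T" "hd u \<notin> X" using ne xu(3,7) hd_in_set[OF ne] by blast+
  obtain y where y: "(x, y) \<in> parcs T" "y \<in> X"
  proof (cases "x = r")
    case True
    have "k \<in> pverts T" using k X by (auto simp: closed_def)
    then have p: "path r (rev (to_root k)) k" using to_root path_rev by blast
    then obtain y q where q: "rev (to_root k) = r # y # q"
      using k(2) by (cases "rev (to_root k)"; cases "tl (rev (to_root k))") (auto simp: path_iff)
    then have "y \<in> set (to_root k)" by (metis list.set_intros(1,2) set_rev)
    moreover have "(r, y) \<in> parcs T" using p q by (auto simp: path_iff)
    ultimately show ?thesis using that closed_to_root[OF X k(1)] True by blast
  next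
    case False
    have "x \<in> pverts T" "parent x \<in> X" using xu(1) X False by (auto simp: closed_def)
    then show ?thesis using that[of "parent x"] to_root_parent(3)[OF _ False] by blast
  qed
  then have "x \<notin> leaves" using hd unfolding leaves_def by blast
  moreover have "set u \<inter> leaves \<subseteq> {l, r}"
    using xu(8) leaf_on_path[OF to_root[OF lV]] by blast
  moreover have "last u = l" using xu(4) ne by simp
  ultimately show ?thesis
    using xu ne parent_edges_Un[of X "set u"] by blast
qed

text \<open>Every vertex other than the root lies on the path from the root to some leaf.\<close>

lemma closed_leaves:
  assumes "closed X" "leaves \<subseteq> X"
  shows "X = pverts T"
proof
  show "pverts T \<subseteq> X"
  proof
    fix v assume v: "v \<in> pverts T"
    show "v \<in> X"
    proof (cases "v = r")
      case True
      then show ?thesis using assms(1) by (simp add: closed_def)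
    next
      case False
      then obtain w p where w: "w \<in> leaves" "path r p w" "v \<in> set p"
        using extend_to_leaf[OF root v] by blast
      then have "to_root w = rev p" using path_rev to_rootI by blast
      then show ?thesis using closed_to_root[OF assms(1), of w] w assms(2) by auto
    qed
  qed
qed (use assms(1) in \<open>simp add: closed_def\<close>)

text \<open>The leaves are added one at a time, through a path, a tripod and a double fork. Since
  the root is a leaf, the initial path has a leaf at both ends.\<close>

theorem strip_layout_five_leaves:
  assumes L: "leaves = {r, l2, l3, l4, l5}" "distinct [r, l2, l3, l4, l5]"
  shows "strip_layout (pverts T) (parcs T)"
proof -
  have fin: "finite X" if "closed X" for X
    using that pair_graph_finite[OF pair_graph] finite_subset by (auto simp: closed_def)
  have r: "r \<in> leaves" using L by simp
  have X0: "closed {r}" using root by (simp add: closed_def)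
  have "l2 \<in> pverts T" using L(1) by (auto simp: leaves_def)
  from grow[OF X0 this] obtain u where u: "distinct u" "set u \<inter> {r} = {}" "last (r # u) = l2"
    "closed ({r} \<union> set u)" "parent_edges (set u) \<subseteq> path_edges (r # u)" "set u \<subseteq> set (to_root l2)"
    by blast
  define X1 where "X1 = {r} \<union> set u"
  have X1: "closed X1" "mset (r # u) = mset_set X1" "parent_edges X1 \<subseteq> path_edges (r # u)"
    using u mset_mset_setI[of "r # u" X1] by (auto simp: X1_def parent_edges_def)
  have l2: "l2 \<in> X1" using u(3) last_in_set[of "r # u"] by (simp add: X1_def)
  \<comment> \<open>A path contains no leaves besides its ends, so the remaining leaves are still
    outside and their legs are non-empty.\<close>
  have X1L: "X1 \<inter> leaves \<subseteq> {r, l2}"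
    using u(6) leaf_on_path[OF to_root[OF \<open>l2 \<in> pverts T\<close>]] by (auto simp: X1_def)
  have ne: "l2 \<noteq> r" using L(2) by auto
  obtain x3 u3 where 3: "x3 \<in> X1" "x3 \<notin> leaves" "u3 \<noteq> []" "distinct u3" "set u3 \<inter> X1 = {}" "last u3 = l3"
    "closed (X1 \<union> set u3)" "parent_edges (X1 \<union> set u3) \<subseteq> parent_edges X1 \<union> path_edges (x3 # u3)"
    "set u3 \<inter> leaves \<subseteq> {l3, r}"
    using grow_leaf[OF X1(1) r _ _ l2 ne, of l3] X1L L by auto
  define X2 where "X2 = X1 \<union> set u3"
  define D2 where "D2 = path_edges (r # u) \<union> path_edges (x3 # u3)"
  have ends: "last u3 \<in> leaves" "hd (r # u) \<in> leaves" "last (r # u) \<in> leaves"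
    using 3(6) u(3) L(1) by auto
  from attach_to_path[OF 3(2-5) ends(1) fin[OF X1(1)] X1(2) 3(1) ends(2,3) subset_refl]
  obtain c p q s where tri: "tripod leaves X2 D2 c p q s"
    unfolding X2_def D2_def by blast
  have X2: "closed X2" "parent_edges X2 \<subseteq> D2" "X2 \<inter> leaves \<subseteq> {r, l2, l3}" "l2 \<in> X2"
    using 3(7-9) X1(3) X1L l2 unfolding X2_def D2_def by auto
  obtain x4 u4 where 4: "x4 \<in> X2" "x4 \<notin> leaves" "u4 \<noteq> []" "distinct u4" "set u4 \<inter> X2 = {}" "last u4 = l4"
    "closed (X2 \<union> set u4)" "parent_edges (X2 \<union> set u4) \<subseteq> parent_edges X2 \<union> path_edges (x4 # u4)"
    "set u4 \<inter> leaves \<subseteq> {l4, r}"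
    using grow_leaf[OF X2(1) r _ _ X2(4) ne, of l4] X2(3) L by auto
  define X3 where "X3 = X2 \<union> set u4"
  define D3 where "D3 = D2 \<union> path_edges (x4 # u4)"
  have "last u4 \<in> leaves" using 4(6) L(1) by auto
  from attach_to_tripod[OF 4(2-5) this tri 4(1)]
  obtain c p q s a b where df: "double_fork leaves X3 D3 c p q s a b"
    unfolding X3_def D3_def by blast
  have X3: "closed X3" "parent_edges X3 \<subseteq> D3" "X3 \<inter> leaves \<subseteq> {r, l2, l3, l4}" "l2 \<in> X3"
    using 4(7-9) X2 unfolding X3_def D3_def by auto
  obtain x5 u5 where 5: "x5 \<in> X3" "x5 \<notin> leaves" "u5 \<noteq> []" "distinct u5" "set u5 \<inter> X3 = {}" "last u5 = l5"
    "closed (X3 \<union> set u5)" "parent_edges (X3 \<union> set u5) \<subseteq> parent_edges X3 \<union> path_edges (x5 # u5)"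
    using grow_leaf[OF X3(1) r _ _ X3(4) ne, of l5] X3(3) L by auto
  have "last u5 \<in> leaves" using 5(6) L(1) by auto
  from attach_to_double_fork[OF 5(2-5) this df 5(1)]
  have lay: "strip_layout (X3 \<union> set u5) (D3 \<union> path_edges (x5 # u5))" .
  have "r \<in> X1" "l3 \<in> set u3" "l4 \<in> set u4" "l5 \<in> set u5"
    using 3(3,6) 4(3,6) 5(3,6) last_in_set by (auto simp: X1_def)
  then have "leaves \<subseteq> X3 \<union> set u5"
    using l2 by (auto simp: L(1) X2_def X3_def)
  then have V: "X3 \<union> set u5 = pverts T" by (rule closed_leaves[OF 5(7)])
  have "parcs T \<subseteq> parent_edges (X3 \<union> set u5)"
    unfolding V by (rule parent_edges_pverts)
  also have "\<dots> \<subseteq> D3 \<union> path_edges (x5 # u5)" using 5(8) X3(2) by blast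
  finally show ?thesis
    using lay unfolding V strip_layout_def by (meson subset_trans)
qed

end

theorem theorem6p4:
  fixes T :: "'a pair_pre_digraph"
  assumes "undirected_tree T"
    and "strong_dimension T = 4"
  shows "threshold_strong_dimension T = 2"
proof -
  interpret tree_graph T by unfold_locales fact
  have "card leaves = 5" using card_leaves assms(2) by simp
  then obtain xs where xs: "set xs = leaves" "distinct xs" "length xs = 5"
    using finite_distinct_list[OF finite_leaves] distinct_card by metis
  then obtain r l2 l3 l4 l5 where l: "xs = [r, l2, l3, l4, l5]"
    by (auto simp: eval_nat_numeral length_Suc_conv)
  have "r \<in> pverts T" using xs(1) l by (auto simp: leaves_def)
  then interpret rooted_tree_graph T r by unfold_locales
  obtain lo A B C where lay: "distinct (A @ B @ C)" "set (A @ B @ C) = pverts T"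
    "1 \<le> lo" "lo \<le> length A" "lo \<le> length B" "parcs T \<subseteq> strip_edges lo A B C"
    using strip_layout_five_leaves[of l2 l3 l4 l5] xs(1,2) unfolding l strip_layout_def by auto
  obtain H where H: "pair_graph H" "connected H" "pverts T = pverts H" "parcs T \<subseteq> parcs H"
    "strong_dimension H \<le> 2"
    using strip_supergraph[OF pair_graph conn lay] by blast
  define P where "P k \<longleftrightarrow> (\<exists>H :: 'a pair_pre_digraph.
      pair_graph H \<and> connected H \<and> spanning T H \<and> strong_dimension H = k)" for k
  have ge: "2 \<le> k" if Pk: "P k" for k
  proof -
    obtain K :: "'a pair_pre_digraph" where
      K: "pair_graph K" "connected K" "spanning T K" "strong_dimension K = k"
      using Pk unfolding P_def by blast
    then have "pverts T = pverts K" "parcs T \<subseteq> parcs K"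
      using spanning_pair_iff[OF pair_graph K(1)] by simp_all
    then show ?thesis
      using strong_dimension_spanning_supergraph_ge_2[OF pair_graph conn K(1,2)] assms(2) K(4) by simp
  qed
  have "P (strong_dimension H)"
    unfolding P_def using H spanning_pair_iff[OF pair_graph H(1)] by blast
  \<comment> \<open>The layout bounds the dimension by 2 and \<open>ge\<close> excludes smaller
    values, so \<open>H\<close> attains the minimum.\<close>
  moreover from this have "strong_dimension H = 2" using ge H(5) by (simp add: le_antisym)
  ultimately have "(LEAST k. P k) = 2" using ge by (intro Least_equality) auto
  then show ?thesis unfolding threshold_strong_dimension_def P_def .
qed

end
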